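(* Let $\mathbb F_q$ be the finite field with $q$ elements, $p=\mathrm{char}\,\mathbb F_q$. For $A=\begin{pmatrix}a&b\\c&d\end{pmatrix}\in \mathrm{GL}_2(\mathbb F_q)$ and an irreducible $f\in\mathbb F_q[x]$ of degree $n\ge 2$, define $A\circ f=(cx+d)^n f\!\left(\frac{ax+b}{cx+d}\right)$. For a subgroup $H\subseteq \mathrm{GL}_2(\mathbb F_q)$ and an integer $n\ge 2$, let $I_H(n)$ be the set of monic irreducible polynomials $f\in\mathbb F_q[x]$ of degree $n$ such that $A\circ f=f$ for all $A\in H$. Let $H$ be a subgroup of $\mathrm{GL}_2(\mathbb F_q)$ of order $p^r$ with $r\ge 1$. Then: (a) if $r>1$ or $p\nmid n$, then $|I_H(n)|=0$; (b) if $r=1$ and $n=pm$ with $m$ a positive integer, then $$|I_H(n)|=\frac{p-1}{pm}\sum_{d\mid m,\ \gcd(d,p)=1}q^{m/d}\mu(d),$$ where $\mu$ is the Möbius function.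
   Context: The action $A\circ f$ is defined on irreducible polynomials of degree at least $2$; it preserves degree and satisfies $A\circ(B\circ f)=(AB)\circ f$. *)

theory Defs
  imports
    "HOL-Analysis.Cartesian_Space"
    "HOL-Computational_Algebra.Polynomial_Factorial"
    "HOL-Computational_Algebra.Squarefree"
    "HOL-Algebra.Group"
begin

definition GL2 :: "('a::field ^ 2 ^ 2) monoid" where
  "GL2 = \<lparr>carrier = {A. invertible A}, monoid.mult = (**), one = mat 1\<rparr>"

lemma group_GL2: "group (GL2 :: ('a::field ^ 2 ^ 2) monoid)"
proof (rule groupI)
  fix A :: "'a ^ 2 ^ 2" assume "A \<in> carrier GL2"
  then obtain B where "A ** B = mat 1" "B ** A = mat 1"
    by (auto simp: GL2_def invertible_def)
  then show "\<exists>B\<in>carrier GL2. B \<otimes>\<^bsub>GL2\<^esub> A = \<one>\<^bsub>GL2\<^esub>"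
    by (auto simp: GL2_def invertible_def)
next
  show "\<one>\<^bsub>GL2\<^esub> \<in> carrier (GL2 :: ('a ^ 2 ^ 2) monoid)"
    by (auto simp: GL2_def invertible_def intro: exI[of _ "mat 1"])
qed (auto simp: GL2_def invertible_mult matrix_mul_assoc)

text \<open>
  The expression \<open>(c x + d)\<^sup>n f((a x + b) / (c x + d))\<close>, where \<open>n\<close> is the degree of \<open>f\<close>,
  with the denominators cleared term by term; \<open>moebius_act_eq_fract\<close> below is the
  identity in the field of rational functions.
\<close>

definition moebius_act :: "'a::field ^ 2 ^ 2 \<Rightarrow> 'a poly \<Rightarrow> 'a poly" where
  "moebius_act A f =
     (\<Sum>i\<le>degree f. smult (coeff f i)
        ([:A $ 1 $ 2, A $ 1 $ 1:] ^ i * [:A $ 2 $ 2, A $ 2 $ 1:] ^ (degree f - i)))"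

lemma to_fract_power: "to_fract (x ^ k) = to_fract x ^ k"
  by (induction k) simp_all

lemma moebius_act_eq_fract:
  fixes A :: "'a::field ^ 2 ^ 2"
  assumes "invertible A"
  shows "to_fract (moebius_act A f) =
     to_fract [:A $ 2 $ 2, A $ 2 $ 1:] ^ degree f *
     poly (map_poly (\<lambda>c. to_fract [:c:]) f)
       (to_fract [:A $ 1 $ 2, A $ 1 $ 1:] / to_fract [:A $ 2 $ 2, A $ 2 $ 1:])"
proof -
  let ?N = "[:A $ 1 $ 2, A $ 1 $ 1:]" and ?D = "[:A $ 2 $ 2, A $ 2 $ 1:]"
  have D: "?D \<noteq> 0"
  proof
    assume "?D = 0"
    then have z: "A $ 2 $ j = 0" for j :: 2
      using exhaust_2[of j] by auto
    obtain B where "A ** B = mat 1"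
      using assms by (auto simp: invertible_def)
    then have "(A ** B) $ 2 $ 2 = (mat 1 :: 'a ^ 2 ^ 2) $ 2 $ 2"
      by simp
    then show False
      by (simp add: matrix_matrix_mult_def mat_def z)
  qed
  have deg: "degree (map_poly (\<lambda>c. to_fract [:c:]) f) = degree f"
    by (rule degree_map_poly) simp
  have "to_fract ?D ^ degree f * poly (map_poly (\<lambda>c. to_fract [:c:]) f) (to_fract ?N / to_fract ?D)
      = (\<Sum>i\<le>degree f. to_fract [:coeff f i:] *
           (to_fract ?N ^ i * (to_fract ?D ^ degree f / to_fract ?D ^ i)))"
    unfolding poly_altdef deg
    by (simp add: coeff_map_poly sum_distrib_left power_divide mult_ac del: to_fract_mult)
  also have "\<dots> = (\<Sum>i\<le>degree f. to_fract [:coeff f i:] *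
           (to_fract ?N ^ i * to_fract ?D ^ (degree f - i)))"
    using D by (intro sum.cong refl) (simp add: power_diff)
  also have "\<dots> = to_fract (moebius_act A f)"
    unfolding moebius_act_def to_fract_sum
    by (intro sum.cong refl)
       (simp only: to_fract_power [symmetric] to_fract_mult [symmetric], simp)
  finally show ?thesis by simp
qed

definition invariant_irreducibles :: "('a::field ^ 2 ^ 2) set \<Rightarrow> nat \<Rightarrow> 'a poly set" where
  "invariant_irreducibles H n =
     {f. lead_coeff f = 1 \<and> irreducible f \<and> degree f = n \<and> (\<forall>A\<in>H. moebius_act A f = f)}"

lemma finite_invariant_irreducibles:
  "finite (invariant_irreducibles (H :: ('a::{field,finite} ^ 2 ^ 2) set) n)"
proof (rule finite_subset)
  show "invariant_irreducibles H n \<subseteq> Poly ` {xs. set xs \<subseteq> UNIV \<and> length xs \<le> Suc n}"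
  proof
    fix f assume "f \<in> invariant_irreducibles H n"
    then have "length (coeffs f) \<le> Suc n"
      by (cases "f = 0") (auto simp: invariant_irreducibles_def length_coeffs)
    then show "f \<in> Poly ` {xs. set xs \<subseteq> UNIV \<and> length xs \<le> Suc n}"
      by (intro image_eqI[of _ _ "coeffs f"]) auto
  qed
  show "finite (Poly ` {xs :: 'a list. set xs \<subseteq> UNIV \<and> length xs \<le> Suc n})"
    by (intro finite_imageI finite_lists_length_le) simp
qed

definition moebius_mu :: "nat \<Rightarrow> int" where
  "moebius_mu d = (if squarefree d then (- 1) ^ card (prime_factors d) else 0)"

end

theory Submission
  imports
    Defs
    "HOL-Algebra.Algebraic_Closure_Type"
    "HOL-Algebra.Multiplicative_Group"
    "HOL-Analysis.Determinants"
    "HOL-Number_Theory.Residues"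
begin

text \<open>
  Let \<open>K\<close> be the algebraic closure of \<open>\<F>\<^sub>q\<close>. A monic irreducible polynomial of degree \<open>n\<close> is
  a Frobenius orbit of size \<open>n\<close> in \<open>K\<close>, and for a matrix \<open>A\<close> with a fixed vector it is
  \<open>A\<close>-invariant iff the Moebius transformation of \<open>A\<close> maps a root into its own orbit. Every element
  of a \<open>p\<close>-subgroup \<open>H\<close> is unipotent, so after conjugation \<open>H\<close> acts by the translations
  \<open>y \<mapsto> y + b\<close> for \<open>b\<close> in a set \<open>V\<close> with \<open>1 \<in> V\<close> and \<open>|V| = |H|\<close>. If \<open>y + 1\<close> lies in the orbit of \<open>y\<close>,
  then \<open>p\<close> divides \<open>n\<close> and \<open>y\<^bsup>q^(n/p)\<^esup> = y + t\<close> with \<open>t\<close> in \<open>\<F>\<^sub>p\<^sup>*\<close>; as the Galois group is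
  cyclic, only translations by elements of \<open>\<F>\<^sub>p\<close> can preserve the orbit. Conversely the
  \<open>(p - 1) q\<^sup>m\<close> solutions of \<open>y\<^bsup>q^m\<^esup> = y + t\<close>, \<open>t \<in> \<F>\<^sub>p\<^sup>*\<close>, are precisely the
  elements of such orbits of size \<open>p m / d\<close> with \<open>d\<close> a divisor of \<open>m\<close> prime to \<open>p\<close>, and
  Moebius inversion gives the formula.
\<close>

no_notation fps_nth (infixl \<open>$\<close> 75)

hide_const (open) Divisibility.prime Divisibility.irreducible Polynomials.degree
  Polynomials.lead_coeff Coset.order up_ring.coeff up_ring.monom module.smult

subsection \<open>Moebius inversion\<close>

text \<open>Only squarefree divisors contribute. They correspond to the subsets of the prime factors
  of n, via products and \<open>prime_factors\<close>, and the signed sum over subsets is the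
  expansion of a product of factors 1 - 1.\<close>

lemma sum_moebius_mu_divisors:
  assumes "n > (0::nat)"
  shows "(\<Sum>d | d dvd n. moebius_mu d) = (if n = 1 then 1 else 0)"
proof -
  let ?P = "prime_factors n"
  have fin: "finite {d. d dvd n}" using assms by simp
  have "(\<Sum>d | d dvd n. moebius_mu d) = (\<Sum>d | d dvd n \<and> squarefree d. (-1) ^ card (prime_factors d))"
    using fin by (intro sum.mono_neutral_cong_right) (auto simp: moebius_mu_def)
  also have "\<dots> = (\<Sum>S\<in>Pow ?P. (-1) ^ card S)"
  proof (rule sum.reindex_bij_witness[where i = "\<lambda>S. \<Prod>S" and j = prime_factors])
    fix S assume S: "S \<in> Pow ?P"
    then have fS: "finite S" and pS: "\<And>p. p \<in> S \<Longrightarrow> prime p"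
      using finite_subset[of S ?P] by auto
    show pf: "prime_factors (\<Prod>S) = S"
      using fS pS by (subst prime_factors_prod) (force simp: prime_prime_factors)+
    have sq: "squarefree (\<Prod>S)"
      using pS by (intro squarefree_prod_coprime) (auto simp: primes_coprime squarefree_prime)
    moreover have "\<Prod>S dvd n"
    proof (rule multiplicity_le_imp_dvd)
      show "\<Prod>S \<noteq> 0" using pS[of 0] fS by auto
      fix p :: nat assume p: "prime p"
      have "multiplicity p (\<Prod>S) \<le> (if p \<in> S then 1 else 0)"
        using sq p pf squarefree_factorial_semiring''[of "\<Prod>S"] 
        by (metis \<open>\<Prod>S \<noteq> 0\<close> not_dvd_imp_multiplicity_0 order_refl prime_factorsI)
      also have "\<dots> \<le> multiplicity p n"
        using S p assms by (auto simp: prime_factors_multiplicity)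
      finally show "multiplicity p (\<Prod>S) \<le> multiplicity p n" .
    qed
    ultimately show "\<Prod>S \<in> {d. d dvd n \<and> squarefree d}" by simp
  next
    fix d assume d: "d \<in> {d. d dvd n \<and> squarefree d}"
    then have d0: "d \<noteq> 0" using assms by auto
    show "prime_factors d \<in> Pow ?P"
      using d assms by (auto intro: dvd_prime_factors[THEN subsetD])
    have "(\<Prod>p\<in>prime_factors d. p ^ multiplicity p d) = d"
      using prod_prime_factors[OF d0] by simp
    moreover have "multiplicity p d = 1" if "p \<in> prime_factors d" for p
      using that d squarefree_factorial_semiring''[OF d0]
      by (metis (mono_tags) Suc_leI antisym_conv mem_Collect_eq One_nat_def prime_factors_multiplicity)
    ultimately show "\<Prod>(prime_factors d) = d" by simp
  qed auto
  also have "\<dots> = (\<Prod>p\<in>?P. (1 - 1))"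
    by (subst prod_diff_conv_sum) auto
  also have "\<dots> = (if n = 1 then 1 else 0)"
    using assms by (auto simp: prime_factorization_empty_iff power_0_left)
  finally show ?thesis .
qed

text \<open>The usual inversion survives the restriction to divisors prime to p because these are
  closed under products and under passing to divisors.\<close>

lemma moebius_inversion_coprime:
  fixes F G :: "nat \<Rightarrow> real"
  assumes FG: "\<And>k. k > 0 \<Longrightarrow> F k = (\<Sum>d | d dvd k \<and> gcd d p = 1. G (k div d))"
    and m: "m > 0"
  shows "G m = (\<Sum>d | d dvd m \<and> gcd d p = 1. F (m div d) * real_of_int (moebius_mu d))"
proof -
  let ?D = "\<lambda>k. {d. d dvd k \<and> gcd d p = 1}"
  have "(\<Sum>d\<in>?D m. F (m div d) * real_of_int (moebius_mu d)) =
      (\<Sum>d\<in>?D m. \<Sum>e\<in>?D (m div d). G (m div d div e) * real_of_int (moebius_mu d))"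
    by (intro sum.cong refl) (use m in \<open>auto simp: FG sum_distrib_right dvd_div_eq_0_iff\<close>)
  also have "\<dots> = (\<Sum>(d,e)\<in>Sigma (?D m) (\<lambda>d. ?D (m div d)). G (m div d div e) * real_of_int (moebius_mu d))"
    by (rule sum.Sigma) (use m in \<open>auto simp: dvd_div_eq_0_iff intro!: finite_divisors_nat\<close>)
  \<comment> \<open>Regroup by k = d * e. Every divisor d of k is automatically prime to p, so the
    inner sum becomes a full divisor sum of \<open>moebius_mu\<close>.\<close>
  also have "\<dots> = (\<Sum>(k,d)\<in>Sigma (?D m) (\<lambda>k. {d. d dvd k}). G (m div k) * real_of_int (moebius_mu d))"
  proof (rule sum.reindex_bij_witness[where i = "\<lambda>(k,d). (d, k div d)" and j = "\<lambda>(d,e). (d * e, d)"])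
    fix a assume "a \<in> Sigma (?D m) (\<lambda>d. ?D (m div d))"
    then obtain d e where a: "a = (d, e)" "d dvd m" "gcd d p = 1" "e dvd m div d" "gcd e p = 1" by auto
    have "d > 0" using a m by (auto intro: Nat.gr0I)
    then show "(case case a of (d, e) \<Rightarrow> (d * e, d) of (k, d) \<Rightarrow> (d, k div d)) = a" using a by simp
    have "d * e dvd m" using a \<open>d > 0\<close>
      by (metis dvd_div_iff_mult mult.commute not_gr0)
    moreover have "gcd (d * e) p = 1" using a by (metis coprime_iff_gcd_eq_1 coprime_mult_left_iff)
    ultimately show "(case a of (d, e) \<Rightarrow> (d * e, d)) \<in> Sigma (?D m) (\<lambda>k. {d. d dvd k})"
      using a by auto
    show "(case case a of (d, e) \<Rightarrow> (d * e, d) of (k, d) \<Rightarrow> G (m div k) * real_of_int (moebius_mu d)) =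
        (case a of (d, e) \<Rightarrow> G (m div d div e) * real_of_int (moebius_mu d))"
      using a by (simp add: div_mult2_eq)
  next
    fix b assume "b \<in> Sigma (?D m) (\<lambda>k. {d. d dvd k})"
    then obtain k d where b: "b = (k, d)" "k dvd m" "gcd k p = 1" "d dvd k" by auto
    then obtain e where e: "k = d * e" by auto
    then have "d > 0" using b m by (auto intro: Nat.gr0I)
    show "(case case b of (k, d) \<Rightarrow> (d, k div d) of (d, e) \<Rightarrow> (d * e, d)) = b" using b by auto
    have "e dvd m div d" using b e \<open>d > 0\<close>
      by (metis dvd_div_iff_mult dvd_mult_left mult.commute not_gr0)
    moreover have "gcd d p = 1" "gcd e p = 1"
      using b e by (metis coprime_iff_gcd_eq_1 coprime_mult_left_iff)+
    ultimately show "(case b of (k, d) \<Rightarrow> (d, k div d)) \<in> Sigma (?D m) (\<lambda>d. ?D (m div d))"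
      using b e \<open>d > 0\<close> by (auto intro: dvd_mult_left)
  qed
  also have "\<dots> = (\<Sum>k\<in>?D m. \<Sum>d | d dvd k. G (m div k) * real_of_int (moebius_mu d))"
    by (rule sum.Sigma[symmetric]) (use m in \<open>auto intro!: finite_divisors_nat Nat.gr0I\<close>)
  also have "\<dots> = (\<Sum>k\<in>?D m. G (m div k) * real_of_int (\<Sum>d | d dvd k. moebius_mu d))"
    by (simp add: sum_distrib_left)
  also have "\<dots> = (\<Sum>k\<in>?D m. if k = 1 then G m else 0)"
  proof (intro sum.cong refl)
    fix k assume "k \<in> ?D m"
    then have "k > 0" using m by (auto intro: Nat.gr0I)
    then show "G (m div k) * real_of_int (\<Sum>d | d dvd k. moebius_mu d) = (if k = 1 then G m else 0)"
      by (simp only: sum_moebius_mu_divisors) auto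
  qed
  also have "\<dots> = G m" using m by (subst sum.delta) auto
  finally show ?thesis by simp
qed

subsection \<open>Frobenius orbits and irreducible polynomials\<close>

lemma prime_CHAR_finite: "prime CHAR('a::{field,finite})"
  by (rule prime_CHAR_semidom) (simp add: finite_imp_CHAR_pos)

text \<open>Multiplication by a nonzero x permutes the nonzero elements; comparing their products
  gives x^(q-1) = 1.\<close>

lemma power_CARD_eq_self:
  fixes x :: "'a::{field,finite}"
  shows "x ^ CARD('a) = x"
proof (cases "x = 0")
  case False
  have "(\<Prod>y\<in>-{0}. y) = (\<Prod>y\<in>-{0}. x * y)"
    by (rule prod.reindex_bij_witness[of _ "\<lambda>y. x * y" "\<lambda>y. y / x"]) (use False in auto)
  also have "\<dots> = x ^ (CARD('a) - 1) * (\<Prod>y\<in>-{0}. y)"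
    by (simp add: prod.distrib Compl_eq_Diff_UNIV card_Diff_singleton)
  finally have "x ^ (CARD('a) - 1) = 1" by simp
  then have "x * x ^ (CARD('a) - 1) = x" by simp
  then show ?thesis
    by (metis One_nat_def Suc_pred finite power_Suc zero_less_card_finite)
qed simp

lemma CARD_field_ge_2: "CARD('a::{field,finite}) \<ge> 2"
proof -
  have "card {0, 1 :: 'a} \<le> CARD('a)" by (rule card_mono) auto
  then show ?thesis by simp
qed

lemma map_poly_to_ac_add: "map_poly to_ac (f + g) = map_poly to_ac f + map_poly to_ac g"
  by (rule poly_eqI) (simp add: coeff_map_poly)

lemma map_poly_to_ac_mult: "map_poly to_ac (f * g) = map_poly to_ac f * map_poly to_ac g"
  by (rule poly_eqI) (simp add: coeff_map_poly coeff_mult to_ac_sum)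

lemma map_poly_to_ac_power: "map_poly to_ac (f ^ n) = map_poly to_ac f ^ n"
  by (induction n) (simp_all add: map_poly_to_ac_mult)

lemma map_poly_to_ac_sum: "map_poly to_ac (\<Sum>i\<in>A. f i) = (\<Sum>i\<in>A. map_poly to_ac (f i))"
  by (induction A rule: infinite_finite_induct) (simp_all add: map_poly_to_ac_add)

lemma degree_map_poly_to_ac [simp]: "degree (map_poly to_ac f) = degree f"
  by (rule degree_map_poly) simp

text \<open>The identity is proved as one of polynomials over F_q: the difference \<open>D\<close>
  of the two sides has degree below q but vanishes at all q elements of the field. It can then be
  evaluated at any z of the closure.\<close>

lemma power_CARD_add_one:
  fixes z :: "'a::{field,finite} alg_closure"
  shows "(z + 1) ^ CARD('a) = z ^ CARD('a) + 1"
proof -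
  let ?q = "CARD('a)"
  define D :: "'a poly" where "D = [:1, 1:] ^ ?q - (monom 1 ?q + 1)"
  have "D = 0"
  proof (rule ccontr)
    assume "D \<noteq> 0"
    have q: "?q \<ge> 2" by (rule CARD_field_ge_2)
    have "degree D \<le> ?q"
      unfolding D_def
      by (intro degree_diff_le degree_add_le) (simp_all add: degree_monom_le degree_linear_power)
    \<comment> \<open>Both powers have leading coefficient 1 in degree q, and q \<ge> 2 keeps the
      constant 1 away from that degree.\<close>
    moreover have "coeff D ?q = 0"
      using lead_coeff_power[of "[:1, 1 :: 'a:]" ?q] q
      by (simp add: D_def degree_linear_power)
    ultimately have "degree D < ?q"
      using \<open>D \<noteq> 0\<close> by (metis le_neq_implies_less leading_coeff_0_iff)
    moreover have "{x. poly D x = 0} = UNIV"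
      by (auto simp: D_def poly_monom power_CARD_eq_self)
    ultimately show False
      using card_poly_roots_bound[OF \<open>D \<noteq> 0\<close>] by simp
  qed
  then have "[:1, 1:] ^ ?q = monom 1 ?q + (1 :: 'a poly)"
    by (simp add: D_def)
  then have "poly (map_poly to_ac ([:1, 1:] ^ ?q)) z = poly (map_poly to_ac (monom 1 ?q + 1)) z"
    by simp
  then show ?thesis
    by (simp add: map_poly_to_ac_power map_poly_to_ac_add map_poly_monom poly_monom map_poly_pCons add.commute)
qed

section \<open>Powers of the Frobenius automorphism of the closure\<close>

definition frob :: "nat \<Rightarrow> 'a::{field,finite} alg_closure \<Rightarrow> 'a alg_closure" where
  "frob i x = x ^ (CARD('a) ^ i)"

lemma frob_0 [simp]: "frob 0 x = x"
  by (simp add: frob_def)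

lemma frob_frob: "frob i (frob j x) = frob (i + j) x"
  by (simp add: frob_def power_add mult.commute flip: power_mult)

lemma frob_1: "frob 1 x = x ^ CARD('a)" for x :: "'a::{field,finite} alg_closure"
  by (simp add: frob_def)

lemma frob_Suc: "frob (Suc i) x = frob 1 (frob i x)"
  by (simp add: frob_frob)

lemma frob_zero [simp]: "frob i 0 = 0"
  by (simp add: frob_def)

lemma frob_one [simp]: "frob i 1 = 1"
  by (simp add: frob_def)

lemma frob_mult: "frob i (x * y) = frob i x * frob i y"
  by (simp add: frob_def power_mult_distrib)

lemma frob_divide: "frob i (x / y) = frob i x / frob i y"
  by (simp add: frob_def power_divide)

lemma frob_add: "frob i (x + y) = frob i x + frob i y"
proof (induction i)
  case (Suc i)
  have "frob 1 (x + y) = frob 1 x + frob 1 y" for x y :: "'a alg_closure"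
  proof (cases "y = 0")
    case False
    \<comment> \<open>Dividing by y reduces additivity to the case of adding 1.\<close>
    have "frob 1 (x + y) = frob 1 y * frob 1 (x / y + 1)"
      using False by (simp add: field_simps flip: frob_mult)
    also have "frob 1 (x / y + 1) = frob 1 (x / y) + 1"
      by (simp only: frob_1 power_CARD_add_one)
    finally show ?thesis
      using False by (simp add: distrib_left flip: frob_mult)
  qed simp
  then show ?case by (simp add: frob_Suc[of i] Suc)
qed simp

lemma frob_diff: "frob i (x - y) = frob i x - frob i y"
  using frob_add[of i "x - y" y] by simp

lemma frob_sum: "frob i (\<Sum>j\<in>A. h j) = (\<Sum>j\<in>A. frob i (h j))"
  by (induction A rule: infinite_finite_induct) (simp_all add: frob_add)

lemma frob_power: "frob i (x ^ k) = frob i x ^ k"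
  by (simp add: frob_def mult.commute flip: power_mult)

lemma frob_eq_0_iff [simp]: "frob i x = 0 \<longleftrightarrow> x = 0"
  by (simp add: frob_def)

lemma frob_eq_iff [simp]: "frob i x = frob i y \<longleftrightarrow> x = y"
  using frob_eq_0_iff[of i "x - y"] by (simp add: frob_diff)

lemma frob_to_ac [simp]: "frob i (to_ac c) = to_ac c"
proof (induction i)
  case (Suc i)
  have "frob 1 (to_ac c) = to_ac c"
    by (simp only: frob_1 to_ac_power[symmetric] power_CARD_eq_self)
  with Suc show ?case by (simp add: frob_Suc[of i])
qed simp

lemma frob_of_nat [simp]: "frob i (of_nat n) = of_nat n"
  using frob_to_ac[of i "of_nat n"] by simp

text \<open>X^q - X has at most q roots, and the q elements of the base field are already among
  them.\<close>

lemma frob_1_eq_self_iff: "frob 1 x = x \<longleftrightarrow> x \<in> range to_ac"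
  for x :: "'a::{field,finite} alg_closure"
proof -
  let ?q = "CARD('a)"
  define D :: "'a alg_closure poly" where "D = monom 1 ?q - [:0, 1:]"
  have q: "?q \<ge> 2" by (rule CARD_field_ge_2)
  have "degree D = ?q"
    unfolding D_def diff_conv_add_uminus using q
    by (subst degree_add_eq_left) (simp_all add: degree_monom_eq)
  then have "D \<noteq> 0" using q by auto
  have R: "{y. poly D y = 0} = {y. frob 1 y = y}"
    by (auto simp: D_def poly_monom frob_def)
  have "range (to_ac :: 'a \<Rightarrow> _) = {y. poly D y = 0}"
  proof (rule card_seteq)
    show "finite {y. poly D y = 0}" using \<open>D \<noteq> 0\<close> by (rule poly_roots_finite)
    show "range to_ac \<subseteq> {y. poly D y = 0}" by (auto simp: R)
    show "card {y. poly D y = 0} \<le> card (range (to_ac :: 'a \<Rightarrow> _))"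
      using card_poly_roots_bound[OF \<open>D \<noteq> 0\<close>] \<open>degree D = ?q\<close>
      by (simp add: card_image inj_to_ac)
  qed
  with R show ?thesis by auto
qed

lemma poly_map_poly_to_ac_frob:
  "poly (map_poly to_ac f) (frob i x) = frob i (poly (map_poly to_ac f) x)"
  by (simp add: poly_altdef frob_sum frob_mult frob_power coeff_map_poly)

text \<open>This is the degree of x over F_q, encoded as the exact period of x under Frobenius. It
  thereby determines all i with \<open>frob i x = x\<close>, which is how it is used
  throughout.\<close>

definition has_deg :: "'a::{field,finite} alg_closure \<Rightarrow> nat \<Rightarrow> bool" where
  "has_deg x n \<longleftrightarrow> n > 0 \<and> (\<forall>i. frob i x = x \<longleftrightarrow> n dvd i)"

lemma has_deg_unique: "has_deg x m \<Longrightarrow> has_deg x n \<Longrightarrow> m = n"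
  unfolding has_deg_def by (meson dvd_antisym dvd_refl)

lemma frob_mult_eq_self: "frob n x = x \<Longrightarrow> frob (n * k) x = x"
proof (induction k)
  case (Suc k)
  then show ?case by (simp flip: frob_frob)
qed simp

lemma frob_mod_eq:
  assumes "frob n x = x"
  shows "frob (i mod n) x = frob i x"
proof -
  have "frob i x = frob (i mod n) (frob (n * (i div n)) x)"
    by (simp add: frob_frob)
  then show ?thesis using frob_mult_eq_self[OF assms] by simp
qed

lemma frob_inj_on_lessThan:
  assumes "has_deg x n"
  shows "inj_on (\<lambda>i. frob i x) {..<n}"
proof (rule linorder_inj_onI)
  fix i j assume ij: "i < j" "i \<in> {..<n}" "j \<in> {..<n}"
  have "frob j x = frob i (frob (j - i) x)" using ij by (simp add: frob_frob)
  moreover have "frob (j - i) x \<noteq> x"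
    using assms ij by (auto simp: has_deg_def dest: dvd_imp_le)
  ultimately show "frob i x \<noteq> frob j x" by simp
qed auto

text \<open>Frobenius maps the finite root set of f to itself, so the orbit of x repeats;
  injectivity of \<open>frob\<close> makes it purely periodic. The least period counts distinct
  roots of f, hence is at most its degree.\<close>

lemma has_deg_if_root:
  assumes "f \<noteq> 0" and "poly (map_poly to_ac f) x = 0"
  obtains n where "has_deg x n" "n \<le> degree f"
proof -
  let ?R = "{y. poly (map_poly to_ac f) y = 0}"
  have f0: "map_poly to_ac f \<noteq> 0" using assms by (simp add: map_poly_eq_0_iff)
  have "finite ?R" using f0 by (rule poly_roots_finite)
  have orb: "frob i x \<in> ?R" for i
    using assms by (simp add: poly_map_poly_to_ac_frob)
  have "\<not> inj (\<lambda>i. frob i x)"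
    using orb \<open>finite ?R\<close>
    by (metis (no_types, lifting) finite_imageD finite_subset image_subsetI infinite_UNIV_nat)
  then obtain i j where ij: "i < j" "frob i x = frob j x"
    by (metis injI linorder_neqE_nat)
  then have "frob i x = frob i (frob (j - i) x)" by (simp add: frob_frob)
  then have ex: "\<exists>n>0. frob n x = x" using ij by (intro exI[of _ "j - i"]) simp
  define n where "n = (LEAST n. n > 0 \<and> frob n x = x)"
  have n: "n > 0" "frob n x = x"
    using LeastI_ex[OF ex] by (simp_all add: n_def)
  have "has_deg x n"
    unfolding has_deg_def
  proof (intro conjI allI iffI n)
    fix i assume "frob i x = x"
    then have "frob (i mod n) x = x" using n by (simp add: frob_mod_eq)
    then have "\<not> i mod n > 0"
      using n(1) not_less_Least[of "i mod n" "\<lambda>n. n > 0 \<and> frob n x = x"]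
      unfolding n_def[symmetric] by simp
    then show "n dvd i" by (simp add: dvd_eq_mod_eq_0)
  qed (auto simp: frob_mult_eq_self n elim!: dvdE)
  moreover have "n \<le> degree f"
  proof -
    have "n = card ((\<lambda>i. frob i x) ` {..<n})"
      using frob_inj_on_lessThan[OF \<open>has_deg x n\<close>] by (simp add: card_image)
    also have "\<dots> \<le> card ?R" using orb \<open>finite ?R\<close> by (intro card_mono) auto
    also have "\<dots> \<le> degree f" using card_poly_roots_bound[OF f0] by simp
    finally show ?thesis .
  qed
  ultimately show ?thesis by (rule that)
qed

text \<open>Applying Frobenius to the coefficients only shifts the factors of the product
  cyclically, so the coefficients are fixed and lie in F_q.\<close>

lemma orbit_poly_over_base:
  assumes "has_deg x n"
  obtains g where "map_poly to_ac g = (\<Prod>i<n. [:- frob i x, 1:])"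
proof -
  let ?F = "map_poly (frob 1) :: 'a alg_closure poly \<Rightarrow> _"
  define G where "G = (\<Prod>i<n. [:- frob i x, 1:])"
  have F_mult: "?F (g * h) = ?F g * ?F h" for g h
    by (rule poly_eqI) (simp only: coeff_map_poly frob_zero coeff_mult frob_sum frob_mult)
  have F_prod: "?F (prod h A) = (\<Prod>i\<in>A. ?F (h i))" for h and A :: "nat set"
    by (induction A rule: infinite_finite_induct) (simp_all add: F_mult del: One_nat_def)
  have F_lin: "?F [:- y, 1:] = [:- frob 1 y, 1:]" for y
    using frob_diff[of 1 0 y] by (simp add: map_poly_pCons del: One_nat_def)
  have "?F G = (\<Prod>i<n. [:- frob (Suc i) x, 1:])"
    unfolding G_def F_prod F_lin frob_frob by simp
  also have "\<dots> = G"
  proof -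
    have n: "n > 0" "frob n x = x" using assms by (auto simp: has_deg_def)
    then obtain m where m: "n = Suc m" by (cases n) auto
    \<comment> \<open>The last factor of the shifted product belongs to \<open>frob n x\<close>,
      which is x again; this closes the cycle.\<close>
    have "(\<Prod>i<n. [:- frob (Suc i) x, 1:]) = (\<Prod>i<m. [:- frob (Suc i) x, 1:]) * [:- frob 0 x, 1:]"
      using n by (simp add: m)
    also have "\<dots> = G" unfolding G_def m prod.lessThan_Suc_shift by (rule mult.commute)
    finally show ?thesis .
  qed
  finally have "frob 1 (coeff G i) = coeff G i" for i
    by (metis coeff_map_poly frob_zero)
  then have "coeff G i \<in> range to_ac" for i
    by (simp only: frob_1_eq_self_iff)
  then have "map_poly to_ac (map_poly of_ac G) = G"
    by (intro poly_eqI) (simp only: coeff_map_poly of_ac_0 to_ac_0 to_ac_of_ac)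
  then show ?thesis using that unfolding G_def by blast
qed

section \<open>Minimal polynomials and the roots of irreducible polynomials\<close>

lemma minimal_polynomial:
  fixes x :: "'a::field alg_closure"
  obtains h :: "'a poly" where "lead_coeff h = 1" "irreducible h"
    "\<And>g. poly (map_poly to_ac g) x = 0 \<longleftrightarrow> h dvd g"
proof -
  let ?root = "\<lambda>g :: 'a poly. poly (map_poly to_ac g) x = 0"
  have "\<exists>g. g \<noteq> 0 \<and> ?root g" by (metis alg_closure_algebraic)
  then obtain h0 where h0: "h0 \<noteq> 0" "?root h0"
    and min: "\<And>g. g \<noteq> 0 \<and> ?root g \<Longrightarrow> degree h0 \<le> degree g"
    using ex_has_least_nat[of "\<lambda>g. g \<noteq> 0 \<and> ?root g" _ degree] by blast
  define h where "h = smult (inverse (lead_coeff h0)) h0"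
  have h: "h \<noteq> 0" "?root h" "lead_coeff h = 1" "degree h = degree h0"
    using h0 by (auto simp: h_def map_poly_smult)
  have root_iff: "?root g \<longleftrightarrow> h dvd g" for g
  proof
    assume "?root g"
    moreover have "g = g div h * h + g mod h" by simp
    ultimately have "?root (g mod h)"
      using h by (metis map_poly_to_ac_add map_poly_to_ac_mult mult_zero_right poly_add poly_mult
          add_cancel_right_left)
    then have "g mod h = 0"
      using min[of "g mod h"] degree_mod_less'[OF h(1), of g] h by (metis not_less)
    then show "h dvd g" by (simp add: mod_eq_0_iff_dvd)
  qed (use h in \<open>auto simp: map_poly_to_ac_mult elim!: dvdE\<close>)
  have "irreducible h"
  proof (rule Factorial_Ring.irreducibleI)
    show "\<not> h dvd 1" using root_iff[of 1] by simp
    fix a b assume ab: "h = a * b"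
    then have "?root a \<or> ?root b" using h(2) by (auto simp: map_poly_to_ac_mult)
    then have "h dvd a \<or> h dvd b" by (simp add: root_iff)
    then show "a dvd 1 \<or> b dvd 1"
      using h(1) unfolding ab
      by (metis dvd_mult_cancel_left dvd_mult_cancel_right mult.right_neutral mult.left_neutral)
  qed (rule h(1))
  then show ?thesis using that h(3) root_iff by blast
qed

lemma dvd_degree_le_imp_smult:
  fixes f g :: "'a::field poly"
  assumes "f dvd g" "g \<noteq> 0" "degree g \<le> degree f"
  obtains c where "g = smult c f"
proof -
  obtain h where h: "g = f * h" using assms by auto
  then have "degree h = 0" using assms by (auto simp: degree_mult_eq)
  then obtain c where "h = [:c:]" by (rule degree_eq_zeroE)
  then show ?thesis using that h by simp
qed

lemma monic_dvd_irreducible_eq: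
  fixes f g :: "'a::field poly"
  assumes "irreducible f" "g dvd f" "\<not> g dvd 1" "lead_coeff f = 1" "lead_coeff g = 1"
  shows "g = f"
proof -
  have "f \<noteq> 0" "g \<noteq> 0" using assms by auto
  have "f dvd g" using assms irreducibleD' by blast
  then obtain c where "g = smult c f"
    using dvd_degree_le_imp_smult dvd_imp_degree_le[OF \<open>g dvd f\<close> \<open>f \<noteq> 0\<close>] \<open>g \<noteq> 0\<close> by blast
  with assms show ?thesis by (auto split: if_splits)
qed

text \<open>A monic irreducible polynomial is the minimal polynomial of each of its roots.\<close>

lemma irreducible_dvd_iff_root:
  assumes "irreducible f" "lead_coeff f = 1" "poly (map_poly to_ac f) x = 0"
  shows "poly (map_poly to_ac g) x = 0 \<longleftrightarrow> f dvd g"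
proof -
  obtain h where h: "lead_coeff h = 1" "irreducible h"
    "\<And>g. poly (map_poly to_ac g) x = 0 \<longleftrightarrow> h dvd g"
    by (rule minimal_polynomial[of x]) blast
  then have "h = f" using assms by (intro monic_dvd_irreducible_eq) (auto simp: irreducible_not_unit)
  with h show ?thesis by simp
qed

text \<open>The orbit polynomial of x has coefficients in F_q and vanishes at x, so f divides it.
  Its degree does not exceed that of f, and both are monic.\<close>

lemma irreducible_eq_orbit_poly:
  fixes f :: "'a::{field,finite} poly"
  assumes "irreducible f" "lead_coeff f = 1" "poly (map_poly to_ac f) x = 0"
  shows "has_deg x (degree f)" "map_poly to_ac f = (\<Prod>i<degree f. [:- frob i x, 1:])"
proof -
  have f0: "f \<noteq> 0" using assms by auto
  obtain n where n: "has_deg x n" "n \<le> degree f"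
    using has_deg_if_root[OF f0 assms(3)] .
  obtain g where g: "map_poly to_ac g = (\<Prod>i<n. [:- frob i x, 1:])"
    using orbit_poly_over_base[OF n(1)] .
  have deg: "degree g = n" 
    using arg_cong[OF g, of degree] by (simp add: degree_prod_sum_eq)
  have "to_ac (lead_coeff g) = lead_coeff (map_poly to_ac g)"
    by (simp add: coeff_map_poly)
  then have lc: "lead_coeff g = 1"
    unfolding g by (simp add: lead_coeff_prod)
  have "0 < n" using n by (simp add: has_deg_def)
  then have "poly (map_poly to_ac g) x = 0"
    unfolding g poly_prod by (intro prod_zero) (auto intro!: bexI[of _ 0])
  then have "f dvd g" using irreducible_dvd_iff_root[OF assms] by simp
  then obtain c where c: "g = f * c" by auto
  moreover have "g \<noteq> 0" using lc by auto
  ultimately have "degree g = degree f + degree c" using f0 by (auto simp: degree_mult_eq)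
  then have "degree c = 0" "n = degree f" using deg n(2) by auto
  moreover have "lead_coeff c = 1" using lc assms(2) by (simp add: c lead_coeff_mult)
  ultimately have "g = f" using c by (metis degree_eq_zeroE lead_coeff_pCons(2) mult.right_neutral
        one_pCons)
  then show "has_deg x (degree f)" "map_poly to_ac f = (\<Prod>i<degree f. [:- frob i x, 1:])"
    using n g \<open>n = degree f\<close> by auto
qed

lemma irreducible_roots_eq_orbit:
  fixes f :: "'a::{field,finite} poly"
  assumes "irreducible f" "lead_coeff f = 1" "poly (map_poly to_ac f) x = 0"
  shows "poly (map_poly to_ac f) y = 0 \<longleftrightarrow> (\<exists>i. y = frob i x)"
proof
  assume "poly (map_poly to_ac f) y = 0"
  then show "\<exists>i. y = frob i x"
    by (auto simp: irreducible_eq_orbit_poly[OF assms] poly_prod)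
qed (use assms in \<open>auto simp: poly_map_poly_to_ac_frob\<close>)

lemma card_roots_irreducible:
  fixes f :: "'a::{field,finite} poly"
  assumes "irreducible f" "lead_coeff f = 1"
  shows "card {y. poly (map_poly to_ac f) y = 0} = degree f"
proof -
  have "f \<noteq> 0" using assms by auto
  then have "degree f > 0"
    using assms irreducible_not_unit is_unit_iff_degree by blast
  then obtain x where x: "poly (map_poly to_ac f) x = 0"
    using alg_closed_imp_poly_has_root[of "map_poly to_ac f"] by auto
  have "{y. poly (map_poly to_ac f) y = 0} = (\<lambda>i. frob i x) ` {..<degree f}"
    by (auto simp: irreducible_eq_orbit_poly(2)[OF assms x] poly_prod)
  then show ?thesis
    using frob_inj_on_lessThan[OF irreducible_eq_orbit_poly(1)[OF assms x]] by (simp add: card_image)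
qed

text \<open>Distinct monic irreducible polynomials share no root, and each has n roots. This turns
  counting polynomials into counting elements of the closure.\<close>

lemma card_roots_of_irreducibles:
  fixes I :: "'a::{field,finite} poly set"
  assumes "finite I" "\<And>f. f \<in> I \<Longrightarrow> irreducible f \<and> lead_coeff f = 1 \<and> degree f = n"
  shows "card {y. \<exists>f\<in>I. poly (map_poly to_ac f) y = 0} = n * card I"
proof -
  have card_roots: "card {y. poly (map_poly to_ac f) y = 0} = n" if "f \<in> I" for f
    using assms(2)[OF that] card_roots_irreducible[of f] by metis
  have "{y. \<exists>f\<in>I. poly (map_poly to_ac f) y = 0} = (\<Union>f\<in>I. {y. poly (map_poly to_ac f) y = 0})"
    by auto
  also have "card \<dots> = (\<Sum>f\<in>I. card {y. poly (map_poly to_ac f) y = 0})"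
  proof (rule card_UN_disjoint[OF assms(1)])
    show "\<forall>f\<in>I. finite {y. poly (map_poly to_ac f) y = 0}"
    proof
      fix f assume "f \<in> I"
      then have "f \<noteq> 0" using assms(2)[of f] by auto
      then show "finite {y. poly (map_poly to_ac f) y = 0}"
        by (intro poly_roots_finite) (simp add: map_poly_eq_0_iff)
    qed
    show "\<forall>f\<in>I. \<forall>g\<in>I. f \<noteq> g \<longrightarrow>
        {y. poly (map_poly to_ac f) y = 0} \<inter> {y. poly (map_poly to_ac g) y = 0} = {}"
    proof (intro ballI impI, rule ccontr)
      fix f g assume fg: "f \<in> I" "g \<in> I" "f \<noteq> g"
      assume "{y. poly (map_poly to_ac f) y = 0} \<inter> {y. poly (map_poly to_ac g) y = 0} \<noteq> {}"
      then obtain y where "poly (map_poly to_ac f) y = 0" "poly (map_poly to_ac g) y = 0" by auto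
      then have "f dvd g" using assms(2) fg irreducible_dvd_iff_root by blast
      then show False
        using fg assms(2) monic_dvd_irreducible_eq irreducible_not_unit by metis
    qed
  qed
  also have "\<dots> = n * card I" by (simp add: card_roots)
  finally show ?thesis .
qed

text \<open>The solutions are the roots of X^(q^m) - X - c. Since p divides q, its derivative is -1,
  so all q^m roots are simple.\<close>

lemma card_frob_eq_add:
  fixes c :: "'a::{field,finite} alg_closure"
  assumes "m > 0"
  shows "card {y. frob m y = y + c} = CARD('a) ^ m"
proof -
  let ?Q = "CARD('a) ^ m"
  define D :: "'a alg_closure poly" where "D = monom 1 ?Q - [:c, 1:]"
  have "CARD('a) \<ge> 2" by (rule CARD_field_ge_2)
  then have Q: "?Q \<ge> 2" using assms by (metis order_trans self_le_power le_trans one_le_numeral)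
  then have deg: "degree D = ?Q"
    unfolding D_def diff_conv_add_uminus by (subst degree_add_eq_left) (simp_all add: degree_monom_eq)
  then have "D \<noteq> 0" using Q by auto
  obtain M where M: "size M = degree D" "D = smult (lead_coeff D) (\<Prod>x\<in>#M. [:- x, 1:])"
    using alg_closed_imp_factorization[OF \<open>D \<noteq> 0\<close>] by blast
  have "(of_nat ?Q :: 'a alg_closure) = 0"
    using assms CHAR_dvd_CARD[where 'a = 'a]
    by (simp add: of_nat_eq_0_iff_char_dvd)
  then have "pderiv D = - 1"
    by (simp add: D_def pderiv_diff pderiv_monom pderiv_pCons one_pCons power_0_left)
  have "count M x \<le> 1" for x
  proof (rule ccontr)
    assume "\<not> count M x \<le> 1"
    then obtain M' where M': "M = add_mset x (add_mset x M')"
      by (metis Suc_le_eq count_add_mset count_greater_zero_iff linorder_not_le insert_DiffM mset_add not_gr_zero One_nat_def Suc_lessD not_less_eq)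
    \<comment> \<open>A repeated linear factor would make x a root of the derivative as
      well.\<close>
    have "D = [:- x, 1:] * ([:- x, 1:] * smult (lead_coeff D) (\<Prod>x\<in>#M'. [:- x, 1:]))"
      by (subst M(2)) (simp only: M' image_mset_add_mset prod_mset.add_mset mult_smult_right mult.assoc)
    from arg_cong[OF this, of pderiv] have "poly (pderiv D) x = 0"
      by (simp only: pderiv_mult poly_add poly_mult) simp
    with \<open>pderiv D = - 1\<close> show False by simp
  qed
  then have "size M = card (set_mset M)"
    by (simp add: size_multiset_overloaded_eq) (metis One_nat_def Suc_leI antisym card_eq_sum count_greater_zero_iff sum.cong)
  moreover have "{y. frob m y = y + c} = {y. poly D y = 0}"
    by (auto simp: D_def poly_monom frob_def algebra_simps)
  moreover have "{y. poly D y = 0} = set_mset M"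
    using \<open>D \<noteq> 0\<close> by (subst M(2)) (auto simp: poly_prod_mset prod_mset_zero_iff)
  ultimately show ?thesis using M(1) deg by simp
qed

subsection \<open>Moebius transformations of roots\<close>

text \<open>At a pole the value is 0 by the convention for division. For invertible A no pole lies
  outside \<open>range to_ac\<close>.\<close>

definition mob :: "'a::field ^ 2 ^ 2 \<Rightarrow> 'a alg_closure \<Rightarrow> 'a alg_closure" where
  "mob A z = (to_ac (A $ 1 $ 1) * z + to_ac (A $ 1 $ 2)) / (to_ac (A $ 2 $ 1) * z + to_ac (A $ 2 $ 2))"

lemma matrix_mult_2x2:
  fixes A B :: "'a::semiring_1 ^ 2 ^ 2"
  shows "(A ** B) $ i $ j = A $ i $ 1 * B $ 1 $ j + A $ i $ 2 * B $ 2 $ j"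
  by (simp add: matrix_matrix_mult_def sum_2)

lemma invertible_2x2_iff:
  fixes A :: "'a::field ^ 2 ^ 2"
  shows "invertible A \<longleftrightarrow> A $ 1 $ 1 * A $ 2 $ 2 - A $ 1 $ 2 * A $ 2 $ 1 \<noteq> 0"
  by (simp add: invertible_det_nz det_2)

lemma mob_denominator_nonzero:
  fixes A :: "'a::field ^ 2 ^ 2"
  assumes "invertible A" "z \<notin> range to_ac"
  shows "to_ac (A $ 2 $ 1) * z + to_ac (A $ 2 $ 2) \<noteq> 0"
proof
  assume *: "to_ac (A $ 2 $ 1) * z + to_ac (A $ 2 $ 2) = 0"
  show False
  proof (cases "A $ 2 $ 1 = 0")
    case True
    with * assms show False by (simp add: invertible_2x2_iff)
  next
    case False
    with * have "z = to_ac (- (A $ 2 $ 2) / A $ 2 $ 1)"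
      by (simp add: field_simps add_eq_0_iff)
    with assms show False by blast
  qed
qed

lemma divide_divide_cancel: "c \<noteq> 0 \<Longrightarrow> (a / c) / (b / c) = a / b" for a b c :: "'a::field"
  by simp

lemma mob_mult:
  assumes "invertible B" "z \<notin> range to_ac"
  shows "mob A (mob B z) = mob (A ** B) z"
proof -
  define D where "D = to_ac (B $ 2 $ 1) * z + to_ac (B $ 2 $ 2)"
  define N where "N = to_ac (B $ 1 $ 1) * z + to_ac (B $ 1 $ 2)"
  have D: "D \<noteq> 0" unfolding D_def by (rule mob_denominator_nonzero[OF assms])
  have "mob A (N / D) = ((to_ac (A $ 1 $ 1) * N + to_ac (A $ 1 $ 2) * D) / D) /
      ((to_ac (A $ 2 $ 1) * N + to_ac (A $ 2 $ 2) * D) / D)"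
    using D by (simp add: mob_def add_divide_distrib)
  also have "\<dots> = (to_ac (A $ 1 $ 1) * N + to_ac (A $ 1 $ 2) * D) /
      (to_ac (A $ 2 $ 1) * N + to_ac (A $ 2 $ 2) * D)"
    by (rule divide_divide_cancel[OF D])
  also have "\<dots> = mob (A ** B) z"
    by (simp add: mob_def matrix_mult_2x2 D_def N_def algebra_simps)
  finally show ?thesis by (simp add: mob_def[of B] D_def N_def)
qed

lemma frob_mob: "frob i (mob A z) = mob A (frob i z)"
  by (simp add: mob_def frob_divide frob_add frob_mult)

lemma mob_mat_1 [simp]: "mob (mat 1) z = z"
  by (simp add: mob_def mat_def)

lemma mob_eq_iff:
  assumes "invertible A" "y \<notin> range to_ac" "z \<notin> range to_ac"
  shows "mob A y = mob A z \<longleftrightarrow> y = z"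
proof
  assume *: "mob A y = mob A z"
  obtain B where B: "B ** A = mat 1" using assms by (auto simp: invertible_def)
  have "mob B (mob A y) = mob B (mob A z)" using * by simp
  then show "y = z" using assms by (simp add: mob_mult B)
qed simp

lemma frob_not_base: "z \<notin> range to_ac \<Longrightarrow> frob i z \<notin> range to_ac"
  by (metis frob_eq_iff frob_to_ac imageE rangeI)

text \<open>A matrix over F_q commutes with Frobenius, and it acts injectively away from the base
  field, so periods are preserved.\<close>

lemma has_deg_mob:
  assumes "invertible A" "z \<notin> range to_ac" "has_deg z n"
  shows "has_deg (mob A z) n"
  using assms by (simp add: has_deg_def frob_mob mob_eq_iff frob_not_base)

lemma has_deg_not_base:
  assumes "has_deg z n" "n \<ge> 2"
  shows "z \<notin> range to_ac"
proof
  assume "z \<in> range to_ac"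
  then have "frob 1 z = z" by (simp only: frob_1_eq_self_iff)
  then have "n dvd 1" using assms(1) unfolding has_deg_def by blast
  with assms(2) show False by simp
qed

lemma poly_moebius_act:
  fixes A :: "'a::field ^ 2 ^ 2"
  assumes "to_ac (A $ 2 $ 1) * z + to_ac (A $ 2 $ 2) \<noteq> 0"
  shows "poly (map_poly to_ac (moebius_act A f)) z =
    (to_ac (A $ 2 $ 1) * z + to_ac (A $ 2 $ 2)) ^ degree f * poly (map_poly to_ac f) (mob A z)"
proof -
  define D where "D = to_ac (A $ 2 $ 1) * z + to_ac (A $ 2 $ 2)"
  define N where "N = to_ac (A $ 1 $ 1) * z + to_ac (A $ 1 $ 2)"
  have D: "D \<noteq> 0" using assms by (simp add: D_def)
  have "poly (map_poly to_ac (moebius_act A f)) z =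
      (\<Sum>i\<le>degree f. to_ac (coeff f i) * (N ^ i * D ^ (degree f - i)))"
    unfolding moebius_act_def D_def N_def
    by (simp add: map_poly_to_ac_sum map_poly_smult map_poly_to_ac_mult map_poly_to_ac_power
        map_poly_pCons poly_sum add.commute mult.commute)
  also have "\<dots> = (\<Sum>i\<le>degree f. D ^ degree f * (to_ac (coeff f i) * (N / D) ^ i))"
    using D by (intro sum.cong refl) (simp add: power_diff power_divide)
  also have "\<dots> = D ^ degree f * poly (map_poly to_ac f) (N / D)"
    by (simp add: poly_altdef coeff_map_poly sum_distrib_left)
  finally show ?thesis by (simp add: D_def N_def mob_def)
qed

lemma degree_moebius_act_le: "degree (moebius_act A f) \<le> degree f"
  unfolding moebius_act_def
proof (rule degree_sum_le)
  fix i assume "i \<in> {..degree f}"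
  have lin: "degree ([:b, a:] ^ k) \<le> k" for a b :: 'a and k
    by (rule order_trans[OF degree_power_le]) simp
  show "degree (smult (coeff f i) ([:A $ 1 $ 2, A $ 1 $ 1:] ^ i *
      [:A $ 2 $ 2, A $ 2 $ 1:] ^ (degree f - i))) \<le> degree f"
    using \<open>i \<in> _\<close> lin[of "A $ 1 $ 2" "A $ 1 $ 1" i] lin[of "A $ 2 $ 2" "A $ 2 $ 1" "degree f - i"]
    by (intro order_trans[OF degree_smult_le] order_trans[OF degree_mult_le]) simp
qed simp

text \<open>\<open>moebius_act A f\<close> vanishes at x iff \<open>mob A x\<close> is a root of f,
  that is, a conjugate of x. In that case it is a scalar multiple of f, and the vector (u, w) fixed
  by A forces the scalar to be 1.\<close>

lemma moebius_act_eq_iff_orbit: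
  fixes f :: "'a::{field,finite} poly"
  assumes f: "irreducible f" "lead_coeff f = 1" "degree f \<ge> 2"
    and x: "poly (map_poly to_ac f) x = 0"
    and A: "invertible A"
    and v: "A $ 1 $ 1 * u + A $ 1 $ 2 * w = u" "A $ 2 $ 1 * u + A $ 2 $ 2 * w = w" "u \<noteq> 0 \<or> w \<noteq> 0"
  shows "moebius_act A f = f \<longleftrightarrow> (\<exists>i. mob A x = frob i x)"
proof -
  let ?g = "moebius_act A f" and ?n = "degree f"
  have deg: "has_deg x ?n" using irreducible_eq_orbit_poly[OF f(1,2) x] by simp
  then have "x \<notin> range to_ac" using f(3) by (rule has_deg_not_base)
  note D = mob_denominator_nonzero[OF A this]
  have orbit: "poly (map_poly to_ac ?g) x = 0 \<longleftrightarrow> (\<exists>i. mob A x = frob i x)"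
    by (simp add: poly_moebius_act[OF D] D irreducible_roots_eq_orbit[OF f(1,2) x])
  have "?g = f" if "poly (map_poly to_ac ?g) x = 0"
  proof -
    have "f dvd ?g" using that irreducible_dvd_iff_root[OF f(1,2) x] by simp
    \<comment> \<open>Only an upper bound on the degree of \<open>?g\<close> is known, so c = 0 is
      still possible here; it is ruled out by c = 1 below.\<close>
    then obtain c where c: "?g = smult c f"
      using dvd_degree_le_imp_smult[of f ?g] degree_moebius_act_le[of A f]
      by (cases "?g = 0") (force, blast)
    \<comment> \<open>The scalar is read off at the fixed point of \<open>A\<close> on the projective line over the base field.\<close>
    have "c = 1"
    proof (cases "w = 0")
      case True
      then have a: "A $ 1 $ 1 = 1" "A $ 2 $ 1 = 0" using v by auto
      \<comment> \<open>The fixed point is infinity, so leading coefficients are compared. With A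
        upper triangular and upper left entry 1, only the summand i = n reaches degree n.\<close>
      have "coeff ?g ?n = (\<Sum>i\<le>?n. if i = ?n then 1 else 0)"
        unfolding moebius_act_def coeff_sum
      proof (intro sum.cong refl)
        fix i assume "i \<in> {..?n}"
        have "[:A $ 1 $ 2, A $ 1 $ 1:] ^ i * [:A $ 2 $ 2, A $ 2 $ 1:] ^ (?n - i) =
            smult (A $ 2 $ 2 ^ (?n - i)) ([:A $ 1 $ 2, 1:] ^ i)"
          by (simp add: a poly_const_pow)
        moreover have "coeff ([:A $ 1 $ 2, 1:] ^ i) ?n = (if i = ?n then 1 else 0)"
          using \<open>i \<in> _\<close> lead_coeff_power[of "[:A $ 1 $ 2, 1:]" ?n]
          by (auto simp: degree_linear_power intro!: coeff_eq_0)
        ultimately show "coeff (smult (coeff f i) ([:A $ 1 $ 2, A $ 1 $ 1:] ^ i *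
            [:A $ 2 $ 2, A $ 2 $ 1:] ^ (?n - i))) ?n = (if i = ?n then 1 else 0)"
          using f(2) by simp
      qed
      then show ?thesis using c f(2) by simp
    next
      case False
      \<comment> \<open>Here the fixed point is s in F_q, and the factor c s + d of the action
        equals 1 there. Evaluation at s determines the scalar, since an irreducible f of degree at
        least 2 has no root in F_q.\<close>
      define s where "s = u / w"
      have s: "A $ 2 $ 1 * s + A $ 2 $ 2 = 1" "A $ 1 $ 1 * s + A $ 1 $ 2 = s"
        using v False by (simp_all add: s_def field_simps)
      then have s': "to_ac (A $ 2 $ 1) * to_ac s + to_ac (A $ 2 $ 2) = 1"
        "to_ac (A $ 1 $ 1) * to_ac s + to_ac (A $ 1 $ 2) = to_ac s"
        by (metis to_ac_1 to_ac_add to_ac_mult)+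
      have "poly (map_poly to_ac ?g) (to_ac s) = poly (map_poly to_ac f) (to_ac s)"
        using poly_moebius_act[of A "to_ac s" f] by (simp add: s' mob_def)
      moreover have "poly (map_poly to_ac f) (to_ac s) \<noteq> 0"
        using irreducible_eq_orbit_poly(1)[OF f(1,2)] has_deg_not_base f(3) by blast
      ultimately show ?thesis by (simp add: c map_poly_smult)
    qed
    with c show ?thesis by simp
  qed
  with x orbit show ?thesis by auto
qed

subsection \<open>Subgroups of prime power order\<close>

text \<open>In characteristic p one has x^(p^r) - 1 = (x - 1)^(p^r).\<close>

lemma power_CHAR_power_eq_1:
  fixes x :: "'b::field"
  assumes "prime CHAR('b)" "x ^ (CHAR('b) ^ r) = 1"
  shows "x = 1"
proof -
  have "((x - 1) + 1) ^ (CHAR('b) ^ r) = (x - 1) ^ (CHAR('b) ^ r) + 1 ^ (CHAR('b) ^ r)"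
    by (rule freshmans_dream'[OF assms(1)]) simp
  with assms(2) show ?thesis by simp
qed

definition transl :: "'a::field \<Rightarrow> 'a ^ 2 ^ 2" where
  "transl b = vector [vector [1, b], vector [0, 1]]"

lemma transl_nth [simp]:
  "transl b $ 1 $ 1 = 1" "transl b $ 1 $ 2 = b" "transl b $ 2 $ 1 = 0" "transl b $ 2 $ 2 = 1"
  by (simp_all add: transl_def)

lemma transl_mult: "transl a ** transl b = transl (a + b)"
  by (simp add: vec_eq_iff forall_2 matrix_mult_2x2 add.commute)

lemma GL2_simps:
  "carrier GL2 = {A. invertible A}" "A \<otimes>\<^bsub>GL2\<^esub> B = A ** B" "\<one>\<^bsub>GL2\<^esub> = mat 1"
  by (simp_all add: GL2_def)

text \<open>
  By Cayley-Hamilton, a power of a matrix and the same power of an eigenvalue are given by the same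
  linear polynomial.
\<close>

lemma GL2_pow_eigenvalue:
  fixes A :: "'a::field ^ 2 ^ 2" and k :: nat
  assumes l: "l * l = to_ac (A $ 1 $ 1 + A $ 2 $ 2) * l - to_ac (A $ 1 $ 1 * A $ 2 $ 2 - A $ 1 $ 2 * A $ 2 $ 1)"
  shows "\<exists>a b. (\<forall>i j. (A [^]\<^bsub>GL2\<^esub> k) $ i $ j = a * A $ i $ j + (if i = j then b else 0)) \<and>
    l ^ k = to_ac a * l + to_ac b"
proof (induction k)
  case 0
  show ?case by (intro exI[of _ 0] exI[of _ 1]) (simp add: GL2_simps mat_def)
next
  case (Suc k)
  define T where "T = A $ 1 $ 1 + A $ 2 $ 2"
  define D where "D = A $ 1 $ 1 * A $ 2 $ 2 - A $ 1 $ 2 * A $ 2 $ 1"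
  obtain a b where ab: "\<And>i j. (A [^]\<^bsub>GL2\<^esub> k) $ i $ j = a * A $ i $ j + (if i = j then b else 0)"
    "l ^ k = to_ac a * l + to_ac b"
    using Suc by blast
  show ?case
  proof (rule exI[of _ "a * T + b"], rule exI[of _ "- a * D"], rule conjI)
    show "\<forall>i j. (A [^]\<^bsub>GL2\<^esub> Suc k) $ i $ j = (a * T + b) * A $ i $ j + (if i = j then - a * D else 0)"
      by (simp add: forall_2 GL2_simps matrix_mult_2x2 ab T_def D_def algebra_simps)
    have "l ^ Suc k = to_ac a * (l * l) + to_ac b * l"
      by (simp add: ab(2) algebra_simps)
    also have "\<dots> = to_ac (a * T + b) * l + to_ac (- a * D)"
      unfolding l T_def[symmetric] D_def[symmetric] by (simp add: algebra_simps)
    finally show "l ^ Suc k = to_ac (a * T + b) * l + to_ac (- a * D)" .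
  qed
qed

lemma det_GL2_pow: "det (A [^]\<^bsub>GL2\<^esub> (k :: nat)) = det A ^ k" for A :: "'a::field ^ 2 ^ 2"
  by (induction k) (simp_all add: GL2_simps det_mul)

text \<open>The determinant and an eigenvalue l both become 1 when raised to the power p^r, hence
  both equal 1. The characteristic polynomial at 1 then yields the trace.\<close>

lemma unipotent_2x2:
  fixes A :: "'a::{field,finite} ^ 2 ^ 2"
  assumes pow: "A [^]\<^bsub>GL2\<^esub> (CHAR('a) ^ r) = mat 1"
  shows "A $ 1 $ 1 * A $ 2 $ 2 - A $ 1 $ 2 * A $ 2 $ 1 = 1" "A $ 1 $ 1 + A $ 2 $ 2 = 2"
proof -
  let ?k = "CHAR('a) ^ r"
  let ?T = "A $ 1 $ 1 + A $ 2 $ 2" and ?D = "A $ 1 $ 1 * A $ 2 $ 2 - A $ 1 $ 2 * A $ 2 $ 1"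
  have "?D ^ ?k = 1"
    using det_GL2_pow[of A ?k] by (simp add: pow det_2 mat_def)
  then show det: "?D = 1"
    by (rule power_CHAR_power_eq_1[OF prime_CHAR_finite])
  obtain l where "poly [:to_ac ?D, - to_ac ?T, 1:] l = 0"
    using alg_closed_imp_poly_has_root[of "[:to_ac ?D, - to_ac ?T, 1:]"] by auto
  then have l: "l * l = to_ac ?T * l - to_ac ?D"
    by (simp add: algebra_simps add_eq_0_iff)
  obtain a b where ab: "\<And>i j. (mat 1 :: 'a ^ 2 ^ 2) $ i $ j = a * A $ i $ j + (if i = j then b else 0)"
    "l ^ ?k = to_ac a * l + to_ac b"
    using GL2_pow_eigenvalue[OF l, of ?k] unfolding pow by blast
  have eqs: "a * A $ 1 $ 1 + b = 1" "a * A $ 2 $ 2 + b = 1" "a * A $ 1 $ 2 = 0" "a * A $ 2 $ 1 = 0"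
    using ab(1)[of 1 1] ab(1)[of 2 2] ab(1)[of 1 2] ab(1)[of 2 1] by (simp_all add: mat_def)
  \<comment> \<open>The identity matrix is a A + b. Either a = 0 and b = 1, or A is scalar and l is
    its diagonal entry; in both cases a l + b = 1.\<close>
  have "l ^ ?k = 1"
  proof (cases "a = 0")
    case True
    then show ?thesis using ab(2) eqs by simp
  next
    case False
    then have A: "A $ 1 $ 2 = 0" "A $ 2 $ 1 = 0" "A $ 2 $ 2 = A $ 1 $ 1"
      using eqs by (auto, metis add_right_cancel mult_cancel_left)
    with l have "(l - to_ac (A $ 1 $ 1)) * (l - to_ac (A $ 1 $ 1)) = 0"
      by (simp add: algebra_simps)
    then have "l = to_ac (A $ 1 $ 1)" by simp
    then show ?thesis using ab(2) eqs(1) by (metis to_ac_1 to_ac_add to_ac_mult)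
  qed
  then have "l = 1" by (intro power_CHAR_power_eq_1[of l r]) (simp_all add: prime_CHAR_finite)
  with l have "to_ac (1 + ?D) = to_ac ?T" by (simp add: algebra_simps)
  then have "1 + ?D = ?T" by (simp only: to_ac_eq_iff)
  with det show "?T = 2" by simp
qed

text \<open>Fix A = 1 + N in H with N nonzero nilpotent. For B = 1 + M in H the product A B also has
  trace 2, so the trace of N M is 0; for nilpotent 2x2 matrices this makes M a multiple of N. The
  basis P has a second column e and first column N e, which spans the kernel of N.\<close>

lemma conjugate_to_translations:
  fixes H :: "('a::{field,finite} ^ 2 ^ 2) set"
  assumes H: "subgroup H GL2" "card H = CHAR('a) ^ r" "r \<ge> 1"
  obtains P where "invertible P" "\<And>A. A \<in> H \<Longrightarrow> \<exists>b. A ** P = P ** transl b"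
    "\<exists>A\<in>H. A ** P = P ** transl 1"
proof -
  interpret GL2: group "GL2 :: ('a ^ 2 ^ 2) monoid" by (rule group_GL2)
  interpret H: group "GL2\<lparr>carrier := H\<rparr>"
    using H(1) by (rule GL2.subgroup_imp_group)
  have unip: "A $ 1 $ 1 * A $ 2 $ 2 - A $ 1 $ 2 * A $ 2 $ 1 = 1" "A $ 1 $ 1 + A $ 2 $ 2 = 2"
    if "A \<in> H" for A
  proof -
    have "A [^]\<^bsub>GL2\<lparr>carrier := H\<rparr>\<^esub> (CHAR('a) ^ r) = mat 1"
      using H.pow_order_eq_1[of A] that H(2) by (simp add: Coset.order_def GL2_simps)
    then have "A [^]\<^bsub>GL2\<^esub> (CHAR('a) ^ r) = mat 1"
      by (simp add: GL2.nat_pow_consistent[symmetric])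
    then show "A $ 1 $ 1 * A $ 2 $ 2 - A $ 1 $ 2 * A $ 2 $ 1 = 1" "A $ 1 $ 1 + A $ 2 $ 2 = 2"
      by (rule unipotent_2x2)+
  qed
  have closed: "A ** B \<in> H" if "A \<in> H" "B \<in> H" for A B
    using subgroup.m_closed[OF H(1) that] by (simp add: GL2_simps)
  have "CHAR('a) ^ r > 1"
    using prime_gt_1_nat[OF prime_CHAR_finite[where 'a = 'a]] H(3)
    by (intro one_less_power) auto
  then have "\<not> H \<subseteq> {mat 1}"
    using H(2) card_mono[of "{mat 1 :: 'a ^ 2 ^ 2}" H] by auto
  then obtain A where A: "A \<in> H" "A \<noteq> mat 1" by auto
  define n1 n2 n3 where "n1 = A $ 1 $ 1 - 1" "n2 = A $ 1 $ 2" "n3 = A $ 2 $ 1"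
  have N: "A $ 1 $ 1 = 1 + n1" "A $ 1 $ 2 = n2" "A $ 2 $ 1 = n3" "A $ 2 $ 2 = 1 - n1"
    using unip(2)[OF A(1)] by (simp_all add: n1_n2_n3_def algebra_simps)
  have n0: "n1 * n1 = - n2 * n3"
    using unip(1)[OF A(1)] by (simp add: N algebra_simps add_eq_0_iff)
  \<comment> \<open>The first relation among m1, m2, m3 says that B - 1 is nilpotent, the second
    that its product with N has trace 0.\<close>
  have rel: "\<exists>m1 m2 m3. B $ 1 $ 1 = 1 + m1 \<and> B $ 1 $ 2 = m2 \<and> B $ 2 $ 1 = m3 \<and> B $ 2 $ 2 = 1 - m1 \<and>
      m1 * m1 = - m2 * m3 \<and> 2 * m1 * n1 + n2 * m3 + n3 * m2 = 0" if B: "B \<in> H" for B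
  proof -
    define m1 where "m1 = B $ 1 $ 1 - 1"
    have M: "B $ 1 $ 1 = 1 + m1" "B $ 2 $ 2 = 1 - m1"
      using unip(2)[OF B] by (simp_all add: m1_def algebra_simps)
    have "m1 * m1 = - B $ 1 $ 2 * B $ 2 $ 1"
      using unip(1)[OF B] by (simp add: M algebra_simps add_eq_0_iff)
    moreover have "2 * m1 * n1 + n2 * B $ 2 $ 1 + n3 * B $ 1 $ 2 = 0"
      using unip(2)[OF closed[OF A(1) B]] by (simp add: matrix_mult_2x2 N M algebra_simps)
    ultimately show ?thesis using M by blast
  qed
  show ?thesis
  proof (cases "n3 = 0")
    case True
    have n1: "n1 = 0" using n0 True by simp
    have n2: "n2 \<noteq> 0"
      using A(2) True n1 by (auto simp: N vec_eq_iff forall_2 mat_def)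
    define P :: "'a ^ 2 ^ 2" where "P = vector [vector [n2, 0], vector [0, 1]]"
    have P: "P $ 1 $ 1 = n2" "P $ 1 $ 2 = 0" "P $ 2 $ 1 = 0" "P $ 2 $ 2 = 1"
      by (simp_all add: P_def)
    show ?thesis
    proof (rule that)
      show "invertible P" using n2 by (simp add: invertible_2x2_iff P)
      show "\<exists>A\<in>H. A ** P = P ** transl 1"
        by (intro bexI[OF _ A(1)]) (simp add: vec_eq_iff forall_2 matrix_mult_2x2 N P True n1)
      fix B assume "B \<in> H"
      from rel[OF this] obtain m1 m2 m3 where
        m: "B $ 1 $ 1 = 1 + m1" "B $ 1 $ 2 = m2" "B $ 2 $ 1 = m3" "B $ 2 $ 2 = 1 - m1"
        "m1 * m1 = - m2 * m3" "2 * m1 * n1 + n2 * m3 + n3 * m2 = 0" by blast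
      then have "m3 = 0" "m1 = 0" using True n1 n2 by auto
      \<comment> \<open>B - 1 sends the second column (0, 1) of P to (m2, 0), which is m2 / n2 times
        the first column.\<close>
      then show "\<exists>b. B ** P = P ** transl b"
        using n2 by (intro exI[of _ "m2 / n2"]) (simp add: vec_eq_iff forall_2 matrix_mult_2x2 m P)
    qed
  next
    case False
    define P :: "'a ^ 2 ^ 2" where "P = vector [vector [n1, 1], vector [n3, 0]]"
    have P: "P $ 1 $ 1 = n1" "P $ 1 $ 2 = 1" "P $ 2 $ 1 = n3" "P $ 2 $ 2 = 0"
      by (simp_all add: P_def)
    show ?thesis
    proof (rule that)
      show "invertible P" using False by (simp add: invertible_2x2_iff P)
      show "\<exists>A\<in>H. A ** P = P ** transl 1"
        by (intro bexI[OF _ A(1)])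
          (simp add: vec_eq_iff forall_2 matrix_mult_2x2 N P n0 algebra_simps)
      fix B assume "B \<in> H"
      from rel[OF this] obtain m1 m2 m3 where
        m: "B $ 1 $ 1 = 1 + m1" "B $ 1 $ 2 = m2" "B $ 2 $ 1 = m3" "B $ 2 $ 2 = 1 - m1"
        and m0: "m1 * m1 = - m2 * m3" and tr: "2 * m1 * n1 + n2 * m3 + n3 * m2 = 0" by blast
      \<comment> \<open>The goal is that B - 1 kills the first column (n1, n3) of P, which is
        \<open>e1\<close> together with \<open>e2\<close>. Squaring brings in m1^2 and n1^2, so that
        \<open>m0\<close>, \<open>n0\<close> and \<open>tr\<close> apply.\<close>
      have "(m1 * n3 - m3 * n1) * (m1 * n3 - m3 * n1) =
          (m1 * m1) * (n3 * n3) - 2 * m1 * n1 * (m3 * n3) + (m3 * m3) * (n1 * n1)"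
        by (simp add: algebra_simps)
      also have "\<dots> = - (m3 * n3) * (2 * m1 * n1 + n2 * m3 + n3 * m2)"
        unfolding n0 m0 by (simp add: algebra_simps)
      finally have e1: "m1 * n3 = m3 * n1" by (simp add: tr)
      have "n3 * (m1 * n1 + m2 * n3) =
          n3 * (2 * m1 * n1 + n2 * m3 + n3 * m2) - n1 * (m1 * n3) - n2 * m3 * n3"
        by (simp add: algebra_simps)
      also have "\<dots> = - m3 * (n1 * n1) - n2 * m3 * n3"
        unfolding tr e1 by (simp add: algebra_simps)
      also have "\<dots> = 0" unfolding n0 by (simp add: algebra_simps)
      finally have e2: "m1 * n1 + m2 * n3 = 0" using False by simp
      show "\<exists>b. B ** P = P ** transl b"
      \<comment> \<open>B - 1 sends the second column (1, 0) of P to (m1, m3), which by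
        \<open>e1\<close> is m3 / n3 times the first column.\<close>
      proof (intro exI[of _ "m3 / n3"])
        show "B ** P = P ** transl (m3 / n3)"
          using False e1 e2
          by (simp add: vec_eq_iff forall_2 matrix_mult_2x2 m P field_simps)
      qed
    qed
  qed
qed

text \<open>Conjugation by P identifies V with H. As V contains 0 and 1 and H is closed under
  products, adding 1 repeatedly stays in V, so V contains the prime field.\<close>

lemma translation_group:
  fixes H :: "('a::{field,finite} ^ 2 ^ 2) set"
  assumes H: "subgroup H GL2" and P: "invertible P"
    and conj: "\<And>A. A \<in> H \<Longrightarrow> \<exists>b. A ** P = P ** transl b"
    and one: "\<exists>A\<in>H. A ** P = P ** transl 1"
  defines "V \<equiv> {b. \<exists>A\<in>H. A ** P = P ** transl b}"
  shows "card V = card H" "of_nat t \<in> V"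
proof -
  obtain Q where Q: "P ** Q = mat 1" "Q ** P = mat 1" using P by (auto simp: invertible_def)
  define \<phi> where "\<phi> b = P ** transl b ** Q" for b
  have eq: "A ** P = P ** transl b \<longleftrightarrow> A = \<phi> b" for A b
    unfolding \<phi>_def by (metis Q matrix_mul_assoc matrix_mul_rid)
  have "inj \<phi>"
  proof (rule injI)
    fix a b assume "\<phi> a = \<phi> b"
    then have "Q ** (\<phi> a ** P) = Q ** (\<phi> b ** P)" by simp
    then have "transl a = transl b"
      by (simp add: \<phi>_def Q matrix_mul_assoc matrix_mul_lid) 
        (metis Q matrix_mul_assoc matrix_mul_lid matrix_mul_rid)
    then have "transl a $ 1 $ 2 = transl b $ 1 $ 2" by simp
    then show "a = b" by simp
  qed
  moreover have "\<phi> ` V = H" using conj by (auto simp: V_def eq)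
  ultimately show "card V = card H"
    by (metis card_image inj_on_subset subset_UNIV)
  show "of_nat t \<in> V"
  proof (induction t)
    case 0
    have "mat 1 \<in> H" using subgroup.one_closed[OF H] by (simp add: GL2_simps)
    moreover have "transl 0 = (mat 1 :: 'a ^ 2 ^ 2)"
      by (simp add: vec_eq_iff forall_2 mat_def)
    ultimately show ?case by (auto simp: V_def intro!: bexI[of _ "mat 1"])
  next
    case (Suc t)
    then obtain A where A: "A \<in> H" "A ** P = P ** transl (of_nat t)" by (auto simp: V_def)
    obtain B where B: "B \<in> H" "B ** P = P ** transl 1" using one by blast
    have "B ** A \<in> H" using subgroup.m_closed[OF H B(1) A(1)] by (simp add: GL2_simps)
    moreover have "B ** A ** P = P ** transl (of_nat (Suc t))"
      by (metis A(2) B(2) matrix_mul_assoc of_nat_Suc transl_mult)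
    ultimately show ?case by (auto simp: V_def)
  qed
qed

text \<open>Count the roots x of the invariant polynomials and substitute x =
  \<open>mob P y\<close>. The action of A on x becomes a translation of y, while P, having entries
  in F_q, preserves degrees and Frobenius orbits.\<close>

lemma card_invariant_irreducibles:
  fixes H :: "('a::{field,finite} ^ 2 ^ 2) set"
  assumes H: "subgroup H GL2" and P: "invertible P"
    and conj: "\<And>A. A \<in> H \<Longrightarrow> \<exists>b. A ** P = P ** transl b"
    and n: "n \<ge> 2"
  defines "V \<equiv> {b. \<exists>A\<in>H. A ** P = P ** transl b}"
  shows "n * card (invariant_irreducibles H n) =
    card {y. has_deg y n \<and> (\<forall>b\<in>V. \<exists>i. y + to_ac b = frob i y)}"
proof -
  let ?I = "invariant_irreducibles H n"
  let ?X = "{y. has_deg y n \<and> (\<forall>b\<in>V. \<exists>i. y + to_ac b = frob i y)}"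
  obtain Q where Q: "P ** Q = mat 1" "Q ** P = mat 1" using P by (auto simp: invertible_def)
  then have Qi: "invertible Q" by (auto simp: invertible_def)
  have inv: "invertible A" if "A \<in> H" for A
    using subgroup.mem_carrier[OF H that] by (simp add: GL2_simps)
  have fixed: "moebius_act A f = f \<longleftrightarrow> (\<exists>i. mob A x = frob i x)"
    if f: "A \<in> H" "irreducible f" "lead_coeff f = 1" "degree f = n" "poly (map_poly to_ac f) x = 0"
    for A f x
  proof (rule moebius_act_eq_iff_orbit)
    obtain b where "A ** P = P ** transl b" using conj[OF f(1)] by blast
    \<comment> \<open>The first column of a translation matrix is (1, 0), so the first column of P
      is the fixed vector of A required by the orbit criterion.\<close>
    then have "(A ** P) $ i $ 1 = (P ** transl b) $ i $ 1" for i by simp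
    then show "A $ 1 $ 1 * P $ 1 $ 1 + A $ 1 $ 2 * P $ 2 $ 1 = P $ 1 $ 1"
      "A $ 2 $ 1 * P $ 1 $ 1 + A $ 2 $ 2 * P $ 2 $ 1 = P $ 2 $ 1"
      by (simp_all add: matrix_mult_2x2)
    show "P $ 1 $ 1 \<noteq> 0 \<or> P $ 2 $ 1 \<noteq> 0" using P by (auto simp: invertible_2x2_iff)
  qed (use f n inv in auto)
  have "n * card ?I = card {x. \<exists>f\<in>?I. poly (map_poly to_ac f) x = 0}"
    by (rule card_roots_of_irreducibles[symmetric, OF finite_invariant_irreducibles])
      (auto simp: invariant_irreducibles_def)
  also have "{x. \<exists>f\<in>?I. poly (map_poly to_ac f) x = 0} =
      {x. has_deg x n \<and> (\<forall>A\<in>H. \<exists>i. mob A x = frob i x)}" (is "?L = ?R")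
  proof (intro equalityI subsetI)
    fix x assume "x \<in> ?L"
    then obtain f where "f \<in> ?I" and f: "poly (map_poly to_ac f) x = 0" by auto
    then have f': "irreducible f" "lead_coeff f = 1" "degree f = n" "\<forall>A\<in>H. moebius_act A f = f"
      by (auto simp: invariant_irreducibles_def)
    then have "has_deg x n" using irreducible_eq_orbit_poly(1)[OF f'(1,2) f] by simp
    then show "x \<in> ?R" using fixed[OF _ f'(1-3) f] f'(4) by simp
  next
    fix x assume x: "x \<in> ?R"
    obtain f where f: "lead_coeff f = 1" "irreducible f"
      "\<And>g. poly (map_poly to_ac g) x = 0 \<longleftrightarrow> f dvd g"
      by (rule minimal_polynomial[of x]) blast
    then have root: "poly (map_poly to_ac f) x = 0" by simp
    have deg: "degree f = n"
      using irreducible_eq_orbit_poly(1)[OF f(2,1) root] x by (auto intro: has_deg_unique)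
    then have "f \<in> ?I"
      using f fixed[OF _ f(2,1) deg root] x by (simp add: invariant_irreducibles_def)
    then show "x \<in> ?L" using root by auto
  qed
  also have "\<dots> = mob P ` ?X"
  proof -
    have tr: "mob A (mob P y) = mob P (y + to_ac b)"
      if "A ** P = P ** transl b" "y \<notin> range to_ac" for A b y
    proof -
      have "mob A (mob P y) = mob P (mob (transl b) y)"
        using P that by (simp add: mob_mult invertible_2x2_iff)
      then show ?thesis by (simp add: mob_def[of "transl b"])
    qed
    have nb: "y + to_ac b \<notin> range to_ac" if "y \<notin> range to_ac" for y and b :: 'a
    proof
      assume "y + to_ac b \<in> range to_ac"
      then obtain c where "y + to_ac b = to_ac c" by auto
      then have "y = to_ac (c - b)" by (simp add: algebra_simps)
      with that show False by blast
    qed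
    have "mob P y \<in> ?R \<longleftrightarrow> y \<in> ?X" if y: "has_deg y n" for y
    proof -
      have y': "y \<notin> range to_ac" using y n by (rule has_deg_not_base)
      \<comment> \<open>Frobenius moves past \<open>mob P\<close>, which is then cancelled by
        injectivity outside the base field.\<close>
      have "(\<exists>i. mob A (mob P y) = frob i (mob P y)) \<longleftrightarrow> (\<exists>i. y + to_ac b = frob i y)"
        if "A ** P = P ** transl b" for A b
        using P y' by (simp add: tr[OF that] frob_mob mob_eq_iff nb frob_not_base)
      then have "(\<forall>A\<in>H. \<exists>i. mob A (mob P y) = frob i (mob P y)) \<longleftrightarrow>
          (\<forall>b\<in>V. \<exists>i. y + to_ac b = frob i y)"
        using conj unfolding V_def by blast
      then show ?thesis using has_deg_mob[OF P y' y] y by simp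
    qed
    moreover have "\<exists>y. has_deg y n \<and> x = mob P y" if "has_deg x n" for x
    proof -
      have x: "x \<notin> range to_ac" using that n by (rule has_deg_not_base)
      have "mob P (mob Q x) = x" by (simp add: mob_mult[OF Qi x] Q)
      then show ?thesis using has_deg_mob[OF Qi x that] by metis
    qed
    ultimately show ?thesis by blast
  qed
  also have "card \<dots> = card ?X"
    by (rule card_image) (use P n in \<open>auto simp: inj_on_def mob_eq_iff has_deg_not_base\<close>)
  finally show ?thesis .
qed

subsection \<open>Orbits preserved by translations\<close>

lemma frob_add_of_nat:
  assumes "frob i y = y + of_nat t"
  shows "frob (i * k) y = y + of_nat (k * t)"
proof (induction k)
  case (Suc k)
  have "frob (i * Suc k) y = frob i (frob (i * k) y)" by (simp add: frob_frob)
  also have "\<dots> = y + of_nat (Suc k * t)" by (simp add: Suc frob_add frob_mult assms algebra_simps)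
  finally show ?case .
qed simp

text \<open>For n \<ge> 2 these are the roots of the monic irreducible polynomials of degree n fixed
  by \<open>transl 1\<close>.\<close>

definition translation_orbits :: "nat \<Rightarrow> 'a::{field,finite} alg_closure set" where
  "translation_orbits n = {y. has_deg y n \<and> (\<exists>i. frob i y = y + 1)}"

lemma of_nat_ac_eq_0_iff:
  "(of_nat t :: 'a::{field,finite} alg_closure) = 0 \<longleftrightarrow> CHAR('a) dvd t"
  by (simp add: of_nat_eq_0_iff_char_dvd)

text \<open>Translation by 1 has order p and acts on y as a power of Frobenius, whose period on y is
  n. Hence p divides n, and that power is a multiple s of n/p with s prime to p; inverting s modulo
  p expresses the power n/p itself as a translation.\<close>

lemma translation_orbitsD:
  fixes y :: "'a::{field,finite} alg_closure"
  assumes "y \<in> translation_orbits n"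
  shows "CHAR('a) dvd n" "\<exists>t. \<not> CHAR('a) dvd t \<and> frob (n div CHAR('a)) y = y + of_nat t"
proof -
  let ?p = "CHAR('a)"
  have p: "prime ?p" by (rule prime_CHAR_finite)
  obtain i where n: "n > 0" "\<And>i. frob i y = y \<longleftrightarrow> n dvd i" and i: "frob i y = y + 1"
    using assms by (auto simp: translation_orbits_def has_deg_def)
  have ik: "frob (i * k) y = y + of_nat k" for k
    using frob_add_of_nat[of i y 1 k] i by simp
  have "frob (i * ?p) y = y" by (simp only: ik) (simp add: of_nat_ac_eq_0_iff)
  then have "n dvd i * ?p" by (simp only: n(2))
  have "frob i y \<noteq> y" by (simp add: i)
  then have "\<not> n dvd i" by (simp only: n(2) not_False_eq_True)
  then show "?p dvd n"
    using p \<open>n dvd i * ?p\<close> by (metis coprime_commute coprime_dvd_mult_left_iff prime_imp_coprime_nat)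
  then obtain m where m: "n = ?p * m" by auto
  then have "m dvd i" using \<open>n dvd i * ?p\<close> p by (simp add: mult.commute prime_gt_0_nat)
  then obtain s where s: "i = m * s" by auto
  have "\<not> ?p dvd s" using \<open>\<not> n dvd i\<close> by (auto simp: m s)
  then have "coprime s ?p" using p by (metis coprime_commute prime_imp_coprime_nat)
  then obtain t where t: "[s * t = 1] (mod ?p)" using cong_solve_coprime_nat by auto
  \<comment> \<open>The congruence modulo p scales to one modulo n = p m, which is all that matters
    for exponents of Frobenius on y.\<close>
  have "(i * t) mod n = m mod n"
    using cong_cmult_leftI[OF t, of m] by (simp add: cong_def m s mult_ac)
  then have "frob m y = y + of_nat t"
    using ik[of t] frob_mod_eq[of n y] n(2) by (metis dvd_refl)
  moreover have "\<not> ?p dvd t"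
  proof
    assume "?p dvd t"
    then have "[s * t = 0] (mod ?p)" by (simp add: cong_0_iff)
    with t have "?p dvd 1" by (metis cong_0_iff cong_sym cong_trans)
    then show False using p by auto
  qed
  moreover have "n div ?p = m" using m p by simp
  ultimately show "\<exists>t. \<not> ?p dvd t \<and> frob (n div ?p) y = y + of_nat t" by auto
qed

text \<open>Translation by b is killed by p, so it is a power of the unique subgroup of order p in a
  cyclic group of order n. That subgroup is generated by the Frobenius power n/p, a translation by
  an element of the prime field.\<close>

lemma translation_orbits_subset_prime_field:
  fixes y :: "'a::{field,finite} alg_closure"
  assumes "y \<in> translation_orbits n" "y + to_ac b = frob j y"
  shows "b \<in> of_nat ` {..<CHAR('a)}"
proof -
  let ?p = "CHAR('a)"
  have p: "prime ?p" by (rule prime_CHAR_finite)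
  obtain t where t: "frob (n div ?p) y = y + of_nat t"
    using translation_orbitsD(2)[OF assms(1)] by blast
  obtain m where m: "n = ?p * m" using translation_orbitsD(1)[OF assms(1)] by auto
  have n: "\<And>i. frob i y = y \<longleftrightarrow> n dvd i"
    using assms by (auto simp: translation_orbits_def has_deg_def)
  have jk: "frob (j * k) y = y + to_ac (of_nat k * b)" for k
  proof (induction k)
    case (Suc k)
    have "frob (j * Suc k) y = frob j (frob (j * k) y)" by (simp add: frob_frob)
    also have "\<dots> = y + to_ac (of_nat (Suc k) * b)"
      by (simp add: Suc frob_add assms(2)[symmetric] frob_mult algebra_simps)
    finally show ?case .
  qed simp
  have "frob (j * ?p) y = y" by (simp add: jk)
  then have "n dvd j * ?p" by (simp only: n)
  then have "m dvd j" using p by (simp add: m mult.commute prime_gt_0_nat)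
  then obtain s where s: "j = m * s" by auto
  have "frob (n div ?p) y = frob m y" using m p by simp
  then have "frob j y = y + of_nat (s * t)"
    using frob_add_of_nat[of m y t s] t s by simp
  then have "to_ac b = to_ac (of_nat (s * t))" using assms(2) by simp
  then have "b = of_nat (s * t)" by (simp only: to_ac_eq_iff)
  also have "\<dots> = of_nat ((s * t) mod ?p)"
    by (simp only: of_nat_eq_iff_cong_CHAR cong_def mod_mod_trivial)
  finally show ?thesis using p by (auto simp: prime_gt_0_nat)
qed

lemma inj_on_of_nat_CHAR: "inj_on (of_nat :: nat \<Rightarrow> 'b::semiring_1_cancel) {..<CHAR('b)}"
  by (auto simp: inj_on_def of_nat_eq_iff_cong_CHAR cong_def)

text \<open>If the power m of Frobenius translates y by t, then y has degree p k with k dividing m,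
  and d = m/k is prime to p, since otherwise that power would fix y. Conversely, iterating the power
  m/d of Frobenius d times multiplies its translation by d, which stays nonzero modulo p.\<close>

lemma frob_translate_partition:
  fixes m :: nat
  assumes "m > 0"
  shows "(\<Union>t\<in>{1..<CHAR('a)}. {y :: 'a::{field,finite} alg_closure. frob m y = y + of_nat t}) =
    (\<Union>d\<in>{d. d dvd m \<and> gcd d CHAR('a) = 1}. translation_orbits (CHAR('a) * (m div d)))"
    (is "?L = ?R")
proof (intro equalityI subsetI)
  let ?p = "CHAR('a)"
  have p: "prime ?p" by (rule prime_CHAR_finite)
  {
    fix y :: "'a alg_closure" assume "y \<in> ?L"
    then obtain t where t: "1 \<le> t" "t < ?p" "frob m y = y + of_nat t" by auto
    then have pt: "\<not> ?p dvd t" by (auto dest: dvd_imp_le)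
    obtain f :: "'a poly" where "f \<noteq> 0" "poly (map_poly to_ac f) y = 0"
      by (rule alg_closure_algebraic)
    then obtain n where n: "has_deg y n" by (rule has_deg_if_root)
    have "coprime t ?p" using pt p by (metis coprime_commute prime_imp_coprime_nat)
    \<comment> \<open>With s inverse to t modulo p, the power m s of Frobenius translates y by
      exactly 1.\<close>
    then obtain s where "[t * s = 1] (mod ?p)" using cong_solve_coprime_nat by auto
    then have "(of_nat (s * t) :: 'a alg_closure) = of_nat 1"
      by (simp only: of_nat_eq_iff_cong_CHAR CHAR_alg_closure mult.commute)
    then have "frob (m * s) y = y + 1" using frob_add_of_nat[OF t(3), of s] by simp
    then have yn: "y \<in> translation_orbits n" using n by (auto simp: translation_orbits_def)
    then obtain k where k: "n = ?p * k" using translation_orbitsD(1) by blast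
    have n': "\<And>i. frob i y = y \<longleftrightarrow> n dvd i" "n > 0" using n by (auto simp: has_deg_def)
    have "frob (m * ?p) y = y"
      using frob_add_of_nat[OF t(3), of ?p] by (simp add: of_nat_ac_eq_0_iff)
    then have "n dvd m * ?p" using n' by simp
    then have "k dvd m" using p by (simp add: k mult.commute prime_gt_0_nat)
    then obtain d where d: "m = k * d" by auto
    have "\<not> ?p dvd d"
    proof
      assume "?p dvd d"
      then have "n dvd m" by (auto simp: k d)
      then have "frob m y = y" using n' by simp
      with t pt show False by (simp add: of_nat_ac_eq_0_iff)
    qed
    then have "gcd d ?p = 1" using p by (metis coprime_commute coprime_iff_gcd_eq_1 prime_imp_coprime_nat)
    moreover have "d > 0" using d assms by (auto intro: Nat.gr0I)
    ultimately show "y \<in> ?R" using yn d k by (auto intro!: exI[of _ d])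
  }
  {
    fix y :: "'a alg_closure" assume "y \<in> ?R"
    then obtain d where d: "d dvd m" "gcd d ?p = 1" "y \<in> translation_orbits (?p * (m div d))" by auto
    obtain t where t: "\<not> ?p dvd t" "frob (m div d) y = y + of_nat t"
      using translation_orbitsD(2)[OF d(3)] p by auto
    have "frob m y = y + of_nat (d * t)" using frob_add_of_nat[OF t(2), of d] d by simp
    also have "\<dots> = y + of_nat ((d * t) mod ?p)"
      by (simp add: of_nat_eq_iff_cong_CHAR cong_def del: of_nat_mult)
    finally have "frob m y = y + of_nat ((d * t) mod ?p)" .
    moreover have "\<not> ?p dvd d * t"
      using t d p by (metis coprime_commute coprime_iff_gcd_eq_1 coprime_dvd_mult_right_iff)
    then have "(d * t) mod ?p \<in> {1..<?p}"
      using p by (auto simp: dvd_eq_mod_eq_0 prime_gt_0_nat)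
    ultimately show "y \<in> ?L" by blast
  }
qed

text \<open>Both unions in the partition are disjoint: a degree determines d, and distinct t below p
  give distinct translations. The p - 1 sets on the translation side have q^m elements each.\<close>

lemma sum_card_translation_orbits:
  fixes m :: nat
  assumes "m > 0"
  shows "(\<Sum>d | d dvd m \<and> gcd d CHAR('a) = 1.
      card (translation_orbits (CHAR('a) * (m div d)) :: 'a::{field,finite} alg_closure set)) =
    (CHAR('a) - 1) * CARD('a) ^ m"
proof -
  let ?p = "CHAR('a)" and ?D = "{d. d dvd m \<and> gcd d CHAR('a) = 1}"
  let ?L = "\<lambda>t. {y :: 'a alg_closure. frob m y = y + of_nat t}"
  let ?T = "\<lambda>d. translation_orbits (?p * (m div d)) :: 'a alg_closure set"
  have p: "prime ?p" by (rule prime_CHAR_finite)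
  have card_L: "card (?L t) = CARD('a) ^ m" for t by (rule card_frob_eq_add[OF assms])
  have fin_L: "finite (?L t)" for t using card_L[of t] card_ge_0_finite[of "?L t"] by simp
  have "(\<Sum>d\<in>?D. card (?T d)) = card (\<Union>d\<in>?D. ?T d)"
  proof (rule card_UN_disjoint[symmetric])
    show "finite ?D" using assms by simp
    have "finite (\<Union>d\<in>?D. ?T d)"
      unfolding frob_translate_partition[OF assms, symmetric] using fin_L by blast
    then show "\<forall>d\<in>?D. finite (?T d)" by (meson UN_upper finite_subset)
    show "\<forall>d\<in>?D. \<forall>e\<in>?D. d \<noteq> e \<longrightarrow> ?T d \<inter> ?T e = {}"
    proof (intro ballI impI, rule ccontr)
      fix d e assume de: "d \<in> ?D" "e \<in> ?D" "d \<noteq> e" "?T d \<inter> ?T e \<noteq> {}"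
      then obtain y :: "'a alg_closure" where "has_deg y (?p * (m div d))" "has_deg y (?p * (m div e))"
        by (auto simp: translation_orbits_def)
      then have "?p * (m div d) = ?p * (m div e)" by (rule has_deg_unique)
      then have "m div d = m div e" using p by simp
      moreover have "m = d * (m div d)" "m = e * (m div e)" using de by auto
      ultimately show False using de(3) assms by (metis mult_cancel2 mult_0_right not_gr0)
    qed
  qed
  also have "\<dots> = card (\<Union>t\<in>{1..<?p}. ?L t)"
    by (rule arg_cong[OF frob_translate_partition[OF assms, symmetric]])
  also have "\<dots> = (\<Sum>t\<in>{1..<?p}. card (?L t))"
  proof (rule card_UN_disjoint)
    show "\<forall>s\<in>{1..<?p}. \<forall>t\<in>{1..<?p}. s \<noteq> t \<longrightarrow> ?L s \<inter> ?L t = {}"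
    proof (intro ballI impI)
      fix s t assume "s \<in> {1..<?p}" "t \<in> {1..<?p}" "s \<noteq> t"
      then have "(of_nat s :: 'a alg_closure) \<noteq> of_nat t"
        using inj_on_eq_iff[OF inj_on_of_nat_CHAR[where 'b = "'a alg_closure"], of s t] by simp
      then show "?L s \<inter> ?L t = {}" by auto
    qed
  qed (use fin_L in auto)
  finally show ?thesis by (simp add: card_L)
qed

section \<open>Both parts of the theorem from the count of translation orbits\<close>

theorem theorem4p1:
  fixes H :: "('a::{field,finite} ^ 2 ^ 2) set" and p q r n :: nat
  assumes q: "q = CARD('a)"
    and p: "p = CHAR('a)"
    and H: "subgroup H GL2"
    and card_H: "card H = p ^ r"
    and r: "r \<ge> 1"
    and n: "n \<ge> 2"
  shows "(r > 1 \<or> \<not> p dvd n \<longrightarrow> card (invariant_irreducibles H n) = 0) \<and>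
         (\<forall>m::nat. r = 1 \<and> m > 0 \<and> n = p * m \<longrightarrow>
            real (card (invariant_irreducibles H n)) =
              (real p - 1) / (real p * real m) *
              (\<Sum>d | d dvd m \<and> gcd d p = 1. real q ^ (m div d) * real_of_int (moebius_mu d)))"
proof -
  have prime_p: "prime p" unfolding p by (rule prime_CHAR_finite)
  obtain P where P: "invertible P" "\<And>A. A \<in> H \<Longrightarrow> \<exists>b. A ** P = P ** transl b"
    "\<exists>A\<in>H. A ** P = P ** transl 1"
    by (rule conjugate_to_translations[OF H card_H[unfolded p] r]) blast
  define V where "V = {b. \<exists>A\<in>H. A ** P = P ** transl b}"
  define S where "S k = {y. has_deg y k \<and> (\<forall>b\<in>V. \<exists>i. y + to_ac b = frob i y)}" for k
  have V: "card V = p ^ r" "\<And>t. of_nat t \<in> V"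
    using translation_group[OF H P] card_H by (simp_all add: V_def)
  have card_S: "k * card (invariant_irreducibles H k) = card (S k)" if "k \<ge> 2" for k
    using card_invariant_irreducibles[OF H P(1,2) that] by (simp add: V_def S_def)
  have S_sub: "S k \<subseteq> translation_orbits k" for k
    using V(2)[of 1] by (fastforce simp: S_def translation_orbits_def)
  have card_Fp: "card (of_nat ` {..<p} :: 'a set) = p"
    unfolding p using inj_on_of_nat_CHAR[where 'b = 'a] by (simp add: card_image)
  show ?thesis
  proof (intro conjI impI allI)
    assume rn: "r > 1 \<or> \<not> p dvd n"
    \<comment> \<open>An element of \<open>S n\<close> would give p dvd n and confine V to the prime
      field, so p^r \<le> p; together these contradict the assumption.\<close>
    have "S n = {}"
    proof (rule ccontr)
      assume "S n \<noteq> {}"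
      then obtain y where y: "y \<in> S n" by auto
      then have y': "y \<in> translation_orbits n" using S_sub by auto
      then have "p dvd n" unfolding p by (rule translation_orbitsD)
      then have "r > 1" using rn by simp
      have "V \<subseteq> of_nat ` {..<p}"
        unfolding p using y translation_orbits_subset_prime_field[OF y'] by (fastforce simp: S_def)
      then have "p ^ r \<le> p"
        using card_mono[of "of_nat ` {..<p}" V] V(1) card_Fp by simp
      moreover have "p ^ 1 < p ^ r"
        using prime_gt_1_nat[OF prime_p] \<open>r > 1\<close> by (rule power_strict_increasing[rotated])
      ultimately show False by simp
    qed
    then show "card (invariant_irreducibles H n) = 0" using card_S[OF n] n by simp
  next
    fix m assume m: "r = 1 \<and> m > 0 \<and> n = p * m"
    \<comment> \<open>For r = 1 the prime field, contained in V, already has as many elements as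
      V.\<close>
    have V_eq: "of_nat ` {..<p} = V"
      by (rule card_seteq) (use V card_Fp m in auto)
    have S_eq: "S k = translation_orbits k" for k
    proof (intro equalityI S_sub subsetI)
      fix y assume "y \<in> (translation_orbits k :: 'a alg_closure set)"
      then obtain i where y: "has_deg y k" "frob i y = y + 1" by (auto simp: translation_orbits_def)
      have "y + to_ac (of_nat t) = frob (i * t) y" for t
        using frob_add_of_nat[of i y 1 t] y by simp
      then show "y \<in> S k" using y by (auto simp: S_def V_eq[symmetric] simp del: to_ac_of_nat)
    qed
    \<comment> \<open>\<open>G k\<close> counts elements of degree p k, so the sum over d prime to p
      is (p - 1) q^k and inversion isolates \<open>G m\<close>, which is n times the number
      sought.\<close>
    define G where "G k = real (card (translation_orbits (p * k) :: 'a alg_closure set))" for k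
    have "(real p - 1) * real q ^ k = (\<Sum>d | d dvd k \<and> gcd d p = 1. G (k div d))" if "k > 0" for k
    proof -
      have "real ((p - 1) * q ^ k) = (\<Sum>d | d dvd k \<and> gcd d p = 1. G (k div d))"
        unfolding p q G_def sum_card_translation_orbits[OF that, symmetric] by simp
      then show ?thesis using prime_gt_0_nat[OF prime_p] by (simp add: of_nat_diff)
    qed
    then have "G m = (\<Sum>d | d dvd m \<and> gcd d p = 1.
        (real p - 1) * real q ^ (m div d) * real_of_int (moebius_mu d))"
      using m by (intro moebius_inversion_coprime) auto
    also have "\<dots> = (real p - 1) * (\<Sum>d | d dvd m \<and> gcd d p = 1. real q ^ (m div d) * real_of_int (moebius_mu d))"
      by (simp add: sum_distrib_left mult.assoc)
    also have "G m = real (p * m) * real (card (invariant_irreducibles H n))"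
      using card_S[OF n] m by (simp add: G_def S_eq flip: of_nat_mult)
    finally show "real (card (invariant_irreducibles H n)) =
              (real p - 1) / (real p * real m) *
              (\<Sum>d | d dvd m \<and> gcd d p = 1. real q ^ (m div d) * real_of_int (moebius_mu d))"
      using m prime_gt_0_nat[OF prime_p] by (simp add: field_simps)
  qed
qed

end
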